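(* For all integers $k\ge 1$ and $0\le i\le k-1$, $$|\mathrm{RedVHC}_k(\mathrm{Av}_{3k-i}(312))|=\underline{\mathrm{Duck}}_{k,i}=\sum_{j=i}^{k-1}\binom{j}{i}\,\mathrm{Duck}_{k,j}.$$
   Context: $S_n$ is the set of permutations $\pi=\pi_1\cdots\pi_n$ of $\{1,\dots,n\}$. $\pi$ is $312$-avoiding if there are no indices $a<b<c$ with $\pi_b<\pi_c<\pi_a$; $\mathrm{Av}_n(312)\subseteq S_n$ is the set of $312$-avoiding permutations of length $n$. The plot of $\pi$ is the set of points $(i,\pi_i)$, $1\le i\le n$. If $\pi_i>\pi_{i+1}$, then $i$ is a descent, $(i,\pi_i)$ is a descent top and $(i+1,\pi_{i+1})$ is a descent bottom. A hook on $\pi$ from $(i,\pi_i)$ to $(j,\pi_j)$, where $i<j$ and $\pi_i<\pi_j$, consists of the vertical segment from $(i,\pi_i)$ up to $(i,\pi_j)$ followed by the horizontal segment from $(i,\pi_j)$ to $(j,\pi_j)$. The point $(i,\pi_i)$ is its southwest (SW) endpoint and $(j,\pi_j)$ its northeast (NE) endpoint. A valid hook configuration on $\pi$ is a set of hooks on $\pi$ such that: (i) the set of SW endpoints of the hooks is exactly the set of descent tops of $\pi$; (ii) no point of the plot lies directly above a hook (for a hook from $(i,\pi_i)$ to $(j,\pi_j)$ there is no $l$ with $i<l<j$ and $\pi_l>\pi_j$); (iii) distinct hooks do not intersect, except at endpoints (the NE endpoint of one hook may be the SW endpoint of another; two hooks sharing the same NE endpoint, or the same SW endpoint, overlap in a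 segment and are not allowed). It is reduced if every point of the plot is a hook endpoint or a descent bottom (or both). For a set $S$ of permutations, $\mathrm{RedVHC}_k(S)$ is the set of all reduced valid hook configurations with exactly $k$ hooks on permutations in $S$ (a configuration includes the data of its underlying permutation). A 3D-Dyck word of length $3k$ is a word with $k$ letters X, $k$ letters Y and $k$ letters Z such that in every prefix the number of X's is at least the number of Y's, which is at least the number of Z's. $\mathrm{Duck}_{k,j}$ is the number of 3D-Dyck words of length $3k$ in which exactly $j$ of the Y's do not have an X immediately before them. An underlined duck word of length $3k$ is a 3D-Dyck word of length $3k$ in which some (possibly zero) of the Y's are underlined, such that no underlined Y has an X immediately before it; $\underline{\mathrm{Duck}}_{k,i}$ is the number of underlined duck words of length $3k$ with exactly $i$ underlined Y's. *)

theory Defs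
  imports
    "HOL-Analysis.Line_Segment"
    "HOL-Analysis.Product_Vector"
    "HOL-Combinatorics.Multiset_Permutations"
    "HOL-Library.Sublist"
begin

text \<open>
  A permutation in \<open>S\<^sub>n\<close> is its one-line word, an element of \<^term>\<open>permutations_of_set {1..n}\<close>.
  Positions run from 1 to n, whereas list indices start at 0; \<open>entry \<pi> i\<close> is \<open>\<pi>\<^sub>i\<close>.
\<close>

definition entry :: "nat list \<Rightarrow> nat \<Rightarrow> nat" where
  "entry \<pi> i = \<pi> ! (i - 1)"

definition avoids_312 :: "nat list \<Rightarrow> bool" where
  "avoids_312 \<pi> \<longleftrightarrow>
     \<not> (\<exists>a b c. 1 \<le> a \<and> a < b \<and> b < c \<and> c \<le> length \<pi> \<and>
          entry \<pi> b < entry \<pi> c \<and> entry \<pi> c < entry \<pi> a)"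

definition Av_312 :: "nat \<Rightarrow> nat list set" where
  "Av_312 n = {\<pi> \<in> permutations_of_set {1..n}. avoids_312 \<pi>}"

definition point :: "nat list \<Rightarrow> nat \<Rightarrow> real \<times> real" where
  "point \<pi> i = (real i, real (entry \<pi> i))"

definition plot :: "nat list \<Rightarrow> (real \<times> real) set" where
  "plot \<pi> = point \<pi> ` {1..length \<pi>}"

definition descents :: "nat list \<Rightarrow> nat set" where
  "descents \<pi> = {i. 1 \<le> i \<and> i < length \<pi> \<and> entry \<pi> i > entry \<pi> (i + 1)}"

definition descent_tops :: "nat list \<Rightarrow> (real \<times> real) set" where
  "descent_tops \<pi> = point \<pi> ` descents \<pi>"

definition descent_bottoms :: "nat list \<Rightarrow> (real \<times> real) set" where
  "descent_bottoms \<pi> = (\<lambda>i. point \<pi> (i + 1)) ` descents \<pi>"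

text \<open>
  A hook on \<open>\<pi>\<close> is encoded by the pair \<open>(i, j)\<close> of the positions of its SW and NE endpoints;
  \<open>hook_curve\<close> is the set of points of the plane that it covers.
\<close>

definition hooks :: "nat list \<Rightarrow> (nat \<times> nat) set" where
  "hooks \<pi> = {(i, j). 1 \<le> i \<and> i < j \<and> j \<le> length \<pi> \<and> entry \<pi> i < entry \<pi> j}"

definition SW :: "nat list \<Rightarrow> nat \<times> nat \<Rightarrow> real \<times> real" where
  "SW \<pi> h = point \<pi> (fst h)"

definition NE :: "nat list \<Rightarrow> nat \<times> nat \<Rightarrow> real \<times> real" where
  "NE \<pi> h = point \<pi> (snd h)"

definition hook_curve :: "nat list \<Rightarrow> nat \<times> nat \<Rightarrow> (real \<times> real) set" where
  "hook_curve \<pi> h =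
     (let corner = (fst (SW \<pi> h), snd (NE \<pi> h))
      in closed_segment (SW \<pi> h) corner \<union> closed_segment corner (NE \<pi> h))"

text \<open>
  In the last condition a common point of two hooks has to be an endpoint of both. Since this
  concerns all common points, two hooks with the same SW endpoint, or with the same NE endpoint,
  are excluded: they overlap in a nondegenerate segment.
\<close>

definition valid_hook_config :: "nat list \<Rightarrow> (nat \<times> nat) set \<Rightarrow> bool" where
  "valid_hook_config \<pi> H \<longleftrightarrow>
     H \<subseteq> hooks \<pi> \<and>
     SW \<pi> ` H = descent_tops \<pi> \<and>
     (\<forall>(i, j) \<in> H. \<not> (\<exists>l. i < l \<and> l < j \<and> entry \<pi> l > entry \<pi> j)) \<and>
     (\<forall>h \<in> H. \<forall>h' \<in> H. h \<noteq> h' \<longrightarrow>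
        hook_curve \<pi> h \<inter> hook_curve \<pi> h' \<subseteq> {SW \<pi> h, NE \<pi> h} \<inter> {SW \<pi> h', NE \<pi> h'})"

definition reduced :: "nat list \<Rightarrow> (nat \<times> nat) set \<Rightarrow> bool" where
  "reduced \<pi> H \<longleftrightarrow> plot \<pi> \<subseteq> SW \<pi> ` H \<union> NE \<pi> ` H \<union> descent_bottoms \<pi>"

definition RedVHC :: "nat \<Rightarrow> nat list set \<Rightarrow> (nat list \<times> (nat \<times> nat) set) set" where
  "RedVHC k S = {(\<pi>, H). \<pi> \<in> S \<and> valid_hook_config \<pi> H \<and> reduced \<pi> H \<and> card H = k}"

datatype letter = X | Y | Z

definition dyck_words_3d :: "nat \<Rightarrow> letter list set" where
  "dyck_words_3d k =
     {w. count_list w X = k \<and> count_list w Y = k \<and> count_list w Z = k \<and>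
         (\<forall>u. prefix u w \<longrightarrow> count_list u X \<ge> count_list u Y \<and> count_list u Y \<ge> count_list u Z)}"

text \<open>The (0-based) positions of the Y's that do not have an X immediately before them.\<close>

definition Y_not_after_X :: "letter list \<Rightarrow> nat set" where
  "Y_not_after_X w = {p. p < length w \<and> w ! p = Y \<and> \<not> (p > 0 \<and> w ! (p - 1) = X)}"

definition Duck :: "nat \<Rightarrow> nat \<Rightarrow> nat" where
  "Duck k j = card {w \<in> dyck_words_3d k. card (Y_not_after_X w) = j}"

text \<open>An underlined duck word is a pair of a word and the set of positions of its underlined Y's.\<close>

definition underlined_duck_words :: "nat \<Rightarrow> (letter list \<times> nat set) set" where
  "underlined_duck_words k = {(w, U). w \<in> dyck_words_3d k \<and> U \<subseteq> Y_not_after_X w}"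

definition underlined_Duck :: "nat \<Rightarrow> nat \<Rightarrow> nat" where
  "underlined_Duck k i = card {(w, U) \<in> underlined_duck_words k. card U = i}"

end

theory Submission
  imports Defs
begin

text \<open>
  The 312-avoiding permutations are the possible outputs of a stack on which the values 1, 2, ... are
  pushed in increasing order. Every position is either a left-to-right maximum (pushes, then a pop)
  or a descent bottom (a pop alone), and the NE endpoints of hooks are left-to-right maxima. Hence no
  point lies above a hook, and two hooks meet only in endpoints iff they are noncrossing as arcs on
  the positions. So the hooks are the unique noncrossing matching between the descents and the set of
  NE endpoints, which may be any set of left-to-right maxima subject to a ballot condition.

  A left-to-right maximum that is not a NE endpoint must be a descent top in a reduced configuration.
  Therefore the permutation with its marked maxima splits uniquely into extra pushes (X), marked
  maxima (Z), unmarked maxima together with the descent bottom that follows (Y), and the remaining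
  descent bottoms (underlined Y). After any prefix of this word, the number of X's minus the number of
  Y's is the height of the stack, and the number of Y's minus the number of Z's is the number of
  unfinished hooks. The word is an underlined duck word, because a push is never directly followed by
  a descent bottom.
\<close>

subsection \<open>Stack outputs\<close>

text \<open>
  A suffix of an underlined duck word whose prefix has \<open>s\<close> more X's than Y's and \<open>t\<close> more Y's
  than Z's, and ends in X iff \<open>x\<close>; the second component of a letter tells whether it is underlined.
\<close>

fun duck_suffix :: "bool \<Rightarrow> nat \<Rightarrow> nat \<Rightarrow> (letter \<times> bool) list \<Rightarrow> bool" where
  "duck_suffix x s t [] \<longleftrightarrow> s = 0 \<and> t = 0"
| "duck_suffix x s t ((X, u) # v) \<longleftrightarrow> \<not> u \<and> duck_suffix True (Suc s) t v"
| "duck_suffix x s t ((Y, u) # v) \<longleftrightarrow> (u \<longrightarrow> \<not> x) \<and> 0 < s \<and> duck_suffix False (s - 1) (Suc t) v"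
| "duck_suffix x s t ((Z, u) # v) \<longleftrightarrow> \<not> u \<and> 0 < t \<and> duck_suffix False s (t - 1) v"

text \<open>
  The counter \<open>c\<close> is the next value to be pushed and \<open>st\<close> the stack: X pushes, Z pushes and pops,
  Y pushes and pops twice, an underlined Y pops. The marks in the output are the NE endpoints.
\<close>

fun run_stack :: "nat \<Rightarrow> nat list \<Rightarrow> (letter \<times> bool) list \<Rightarrow> (nat \<times> bool) list" where
  "run_stack c st [] = []"
| "run_stack c st ((X, u) # v) = run_stack (Suc c) (c # st) v"
| "run_stack c st ((Y, u) # v) =
     (if u then (hd st, False) # run_stack c (tl st) v
      else (c, False) # (hd st, False) # run_stack (Suc c) (tl st) v)"
| "run_stack c st ((Z, u) # v) = (c, True) # run_stack (Suc c) st v"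

text \<open>The head of a list can only be the 3 of a 312 pattern. When the entries are distinct, it
  is no such 3 exactly if the smaller entries after it decrease.\<close>

fun av312 :: "nat list \<Rightarrow> bool" where
  "av312 [] \<longleftrightarrow> True"
| "av312 (h # \<sigma>) \<longleftrightarrow> sorted_wrt (>) (filter (\<lambda>x. x < h) \<sigma>) \<and> av312 \<sigma>"

text \<open>
  The values below \<open>c\<close> have been pushed, and those on the stack \<open>st\<close> have not yet been popped.
\<close>

definition stack_output :: "nat \<Rightarrow> nat list \<Rightarrow> nat list \<Rightarrow> bool" where
  "stack_output c st \<sigma> \<longleftrightarrow> distinct \<sigma> \<and> (\<exists>m\<ge>c. set \<sigma> = set st \<union> {c..<m}) \<and>
     st = filter (\<lambda>x. x < c) \<sigma> \<and> sorted_wrt (>) st \<and> av312 \<sigma>"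

text \<open>
  The suffix of a permutation after a prefix with maximum \<open>c - 1\<close> and \<open>t\<close> unfinished hooks. The
  entries below the running maximum are the descent bottoms, and a hook is counted from the
  descent bottom that follows its SW endpoint. An unmarked left-to-right maximum has to be a descent
  top for the configuration to be reduced.
\<close>

fun marking :: "nat \<Rightarrow> nat \<Rightarrow> (nat \<times> bool) list \<Rightarrow> bool" where
  "marking c t [] \<longleftrightarrow> t = 0"
| "marking c t ((h, e) # l) \<longleftrightarrow>
     (if h < c then \<not> e \<and> marking c (Suc t) l
      else if e then 0 < t \<and> marking (Suc h) (t - 1) l
      else l \<noteq> [] \<and> fst (hd l) \<le> h \<and> marking (Suc h) t l)"

section \<open>The effect of a single push or pop\<close>

lemma filter_less_Suc:
  "c \<notin> set \<sigma> \<Longrightarrow> filter (\<lambda>x. x < Suc c) \<sigma> = filter (\<lambda>x. x < (c::nat)) \<sigma>"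
  by (rule filter_cong) (auto simp: less_Suc_eq)

lemma stack_outputI:
  assumes "distinct \<sigma>" "c \<le> m" "set \<sigma> = set st \<union> {c..<m}"
    and "filter (\<lambda>x. x < c) \<sigma> = st" "sorted_wrt (>) st" "av312 \<sigma>"
  shows "stack_output c st \<sigma>"
  unfolding stack_output_def using assms by blast

lemma stack_outputE:
  assumes "stack_output c st \<sigma>"
  obtains m where "distinct \<sigma>" "c \<le> m" "set \<sigma> = set st \<union> {c..<m}"
    "filter (\<lambda>x. x < c) \<sigma> = st" "sorted_wrt (>) st" "av312 \<sigma>" "\<forall>y\<in>set st. y < c"
proof -
  from assms obtain m where m: "c \<le> m" "set \<sigma> = set st \<union> {c..<m}"
    and rest: "distinct \<sigma>" "st = filter (\<lambda>x. x < c) \<sigma>" "sorted_wrt (>) st" "av312 \<sigma>"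
    unfolding stack_output_def by blast
  have "\<forall>y\<in>set st. y < c" by (subst rest(2)) simp
  with that m rest show thesis by metis
qed

lemma stack_output_Nil [simp]: "stack_output c st [] \<longleftrightarrow> st = []"
  by (auto simp: stack_output_def intro: exI[of _ c])

text \<open>A value below \<open>c\<close> was pushed earlier, so it can only leave from the top of
  the stack. Conversely, the remaining entries below \<open>h\<close> all lie on the decreasing
  stack, so \<open>h\<close> starts no 312 pattern.\<close>

lemma stack_output_pop:
  assumes "h < c"
  shows "stack_output c st (h # \<sigma>) \<longleftrightarrow>
    (\<exists>st'. st = h # st' \<and> sorted_wrt (>) st \<and> stack_output c st' \<sigma>)"
proof
  assume "stack_output c st (h # \<sigma>)"
  then obtain m where m: "c \<le> m" "set (h # \<sigma>) = set st \<union> {c..<m}"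
    and dist: "distinct (h # \<sigma>)" and fil: "filter (\<lambda>x. x < c) (h # \<sigma>) = st"
    and srt: "sorted_wrt (>) st" and av: "av312 (h # \<sigma>)" by (rule stack_outputE)
  define st' where "st' = filter (\<lambda>x. x < c) \<sigma>"
  have st: "st = h # st'" using fil assms by (simp add: st'_def)
  have "set \<sigma> = set (h # \<sigma>) - {h}" using dist by auto
  also have "\<dots> = (insert h (set st') \<union> {c..<m}) - {h}" unfolding m(2) st by simp
  also have "\<dots> = set st' \<union> {c..<m}" using dist assms by (auto simp: st'_def)
  finally have "stack_output c st' \<sigma>"
    using dist m(1) srt av by (intro stack_outputI[of _ _ m]) (simp_all add: st st'_def)
  with st srt show "\<exists>st'. st = h # st' \<and> sorted_wrt (>) st \<and> stack_output c st' \<sigma>" by blast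
next
  assume "\<exists>st'. st = h # st' \<and> sorted_wrt (>) st \<and> stack_output c st' \<sigma>"
  then obtain st' where st: "st = h # st'" and sorted: "sorted_wrt (>) (h # st')"
    and out: "stack_output c st' \<sigma>" by blast
  from out obtain m where m: "c \<le> m" "set \<sigma> = set st' \<union> {c..<m}"
    and dist: "distinct \<sigma>" and fil: "filter (\<lambda>x. x < c) \<sigma> = st'"
    and av: "av312 \<sigma>" by (rule stack_outputE)
  have "h \<notin> set st'" using sorted by auto
  with m(2) assms have h: "h \<notin> set \<sigma>" by simp
  have "filter (\<lambda>x. x < h) \<sigma> = filter (\<lambda>x. x < h) st'"
    unfolding fil[symmetric] filter_filter using assms by (intro filter_cong) auto
  then have "sorted_wrt (>) (filter (\<lambda>x. x < h) \<sigma>)"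
    using sorted by (simp add: sorted_wrt_filter)
  then show "stack_output c st (h # \<sigma>)"
    using h dist fil st sorted assms m av by (intro stack_outputI[of _ _ m]) simp_all
qed

text \<open>The value \<open>c\<close> passes through without touching the stack: the smaller
  entries still to come are exactly \<open>st\<close>, so avoidance at \<open>c\<close> amounts to
  \<open>st\<close> being decreasing.\<close>

lemma stack_output_push_pop:
  "stack_output c st (c # \<sigma>) \<longleftrightarrow> stack_output (Suc c) st \<sigma> \<and> (\<forall>y\<in>set st. y < c)"
proof
  assume "stack_output c st (c # \<sigma>)"
  then obtain m where m: "c \<le> m" "set (c # \<sigma>) = set st \<union> {c..<m}"
    and dist: "distinct (c # \<sigma>)" and fil: "filter (\<lambda>x. x < c) (c # \<sigma>) = st"
    and srt: "sorted_wrt (>) st" and av: "av312 (c # \<sigma>)" and less: "\<forall>y\<in>set st. y < c"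
    by (rule stack_outputE)
  have "c \<in> set st \<union> {c..<m}" unfolding m(2)[symmetric] by simp
  then have "Suc c \<le> m" using less by auto
  have "set \<sigma> = set (c # \<sigma>) - {c}" using dist by auto
  also have "\<dots> = set st \<union> {Suc c..<m}" unfolding m(2) using less by auto
  finally have "stack_output (Suc c) st \<sigma>"
    using dist fil srt av \<open>Suc c \<le> m\<close>
    by (intro stack_outputI[of _ _ m]) (simp_all add: filter_less_Suc)
  with less show "stack_output (Suc c) st \<sigma> \<and> (\<forall>y\<in>set st. y < c)" by simp
next
  assume R: "stack_output (Suc c) st \<sigma> \<and> (\<forall>y\<in>set st. y < c)"
  then have "stack_output (Suc c) st \<sigma>" by simp
  then obtain m where m: "Suc c \<le> m" "set \<sigma> = set st \<union> {Suc c..<m}"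
    and dist: "distinct \<sigma>" and fil: "filter (\<lambda>x. x < Suc c) \<sigma> = st"
    and srt: "sorted_wrt (>) st" and av: "av312 \<sigma>"
    by (rule stack_outputE)
  have c: "c \<notin> set \<sigma>" unfolding m(2) using R by auto
  have "set (c # \<sigma>) = set st \<union> {c..<m}" unfolding list.set m(2) using m(1) by auto
  moreover have "filter (\<lambda>x. x < c) \<sigma> = st" using fil filter_less_Suc[OF c] by simp
  ultimately show "stack_output c st (c # \<sigma>)"
    using c dist srt av m(1) by (intro stack_outputI[of _ _ m]) simp_all
qed

text \<open>Since \<open>h\<close> exceeds \<open>c\<close>, the value \<open>c\<close> is still to
  come and waits on the stack. It is the top, because a smaller entry before it would form a 312
  pattern with \<open>h\<close> and \<open>c\<close>.\<close>

lemma stack_output_push: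
  assumes "c < h"
  shows "stack_output c st (h # \<sigma>) \<longleftrightarrow> stack_output (Suc c) (c # st) (h # \<sigma>)"
proof
  assume "stack_output c st (h # \<sigma>)"
  then obtain m where m: "c \<le> m" "set (h # \<sigma>) = set st \<union> {c..<m}"
    and dist: "distinct (h # \<sigma>)" and fil: "filter (\<lambda>x. x < c) (h # \<sigma>) = st"
    and srt: "sorted_wrt (>) st" and av: "av312 (h # \<sigma>)" and less: "\<forall>y\<in>set st. y < c"
    by (rule stack_outputE)
  have "h \<in> set st \<union> {c..<m}" unfolding m(2)[symmetric] by simp
  then have "h < m" using less assms by auto
  with assms have "c \<in> set (h # \<sigma>)" unfolding m(2) by simp
  with assms obtain ys zs where \<sigma>: "\<sigma> = ys @ c # zs" by (auto dest: split_list)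
  have "y > c" if "y \<in> set ys" for y
  proof (cases "y < h")
    case True
    then show ?thesis using av that assms by (auto simp: \<sigma> sorted_wrt_append)
  qed (use assms in simp)
  then have ys: "filter (\<lambda>x. x < Suc c) ys = []" "filter (\<lambda>x. x < c) ys = []"
    by (fastforce simp: filter_empty_conv)+
  have "filter (\<lambda>x. x < Suc c) zs = st"
    using fil assms ys dist by (simp add: \<sigma> filter_less_Suc)
  with ys assms have "filter (\<lambda>x. x < Suc c) (h # \<sigma>) = c # st" by (simp add: \<sigma>)
  moreover have "set (h # \<sigma>) = set (c # st) \<union> {Suc c..<m}"
    unfolding m(2) using \<open>h < m\<close> assms by auto
  ultimately show "stack_output (Suc c) (c # st) (h # \<sigma>)"
    using dist srt less av assms \<open>h < m\<close> by (intro stack_outputI[of _ _ m]) simp_all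
next
  assume "stack_output (Suc c) (c # st) (h # \<sigma>)"
  then obtain m where m: "Suc c \<le> m" "set (h # \<sigma>) = set (c # st) \<union> {Suc c..<m}"
    and dist: "distinct (h # \<sigma>)" and fil: "filter (\<lambda>x. x < Suc c) (h # \<sigma>) = c # st"
    and srt: "sorted_wrt (>) (c # st)" and av: "av312 (h # \<sigma>)" by (rule stack_outputE)
  have "filter (\<lambda>x. x < c) (h # \<sigma>) = filter (\<lambda>x. x < c) (c # st)"
    unfolding fil[symmetric] filter_filter by (intro filter_cong) auto
  also have "\<dots> = st" using srt by (simp add: filter_id_conv)
  finally have "filter (\<lambda>x. x < c) (h # \<sigma>) = st" .
  moreover have "set (h # \<sigma>) = set st \<union> {c..<m}" unfolding m(2) using m(1) by auto
  ultimately show "stack_output c st (h # \<sigma>)"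
    using dist srt av m(1) by (intro stack_outputI[of _ _ m]) simp_all
qed

section \<open>The stack as a bijection between words and marked outputs\<close>

text \<open>The word cannot end while \<open>s\<close> is positive, and an underlined Y cannot
  follow an X, so the next output is a freshly pushed value. This makes pushes visible in the
  output.\<close>

lemma run_stack_after_X:
  "duck_suffix True s t v \<Longrightarrow> 0 < s \<Longrightarrow> \<exists>h e l. run_stack c st v = (h, e) # l \<and> c \<le> h"
proof (induction v arbitrary: s c st)
  case (Cons a v)
  obtain z u where a: "a = (z, u)" by force
  show ?case
  proof (cases z)
    case X
    then obtain h e l where "run_stack (Suc c) (c # st) v = (h, e) # l" "Suc c \<le> h"
      using Cons a by fastforce
    then show ?thesis using X a by auto
  qed (use Cons a in auto)
qed simp

lemma run_stack_correct:
  assumes "duck_suffix x (length st) t v" "sorted_wrt (>) st" "\<forall>y\<in>set st. y < c"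
  shows "stack_output c st (map fst (run_stack c st v)) \<and> marking c t (run_stack c st v)"
  using assms
proof (induction v arbitrary: x t c st)
  case (Cons a v)
  obtain z u where a: "a = (z, u)" by force
  show ?case
  proof (cases z)
    case X
    have ok: "duck_suffix True (length (c # st)) t v" using Cons a X by simp
    \<comment> \<open>The next output exceeds \<open>c\<close>, which is what
      \<open>stack_output_push\<close> requires.\<close>
    then obtain h e l where run: "run_stack (Suc c) (c # st) v = (h, e) # l" "Suc c \<le> h"
      using run_stack_after_X by fastforce
    have "stack_output (Suc c) (c # st) (map fst (run_stack (Suc c) (c # st) v)) \<and>
        marking (Suc c) t (run_stack (Suc c) (c # st) v)"
      using ok Cons.prems by (intro Cons.IH) (auto simp: less_Suc_eq)
    then show ?thesis using run a X stack_output_push[of c h st "map fst l"]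
      by auto
  next
    case Y
    then obtain y st' where st: "st = y # st'" using Cons.prems a by (cases st) auto
    have ok: "duck_suffix False (length st') (Suc t) v" using Cons.prems a Y st by simp
    show ?thesis
    proof (cases u)
      case True
      have "stack_output c st' (map fst (run_stack c st' v)) \<and> marking c (Suc t) (run_stack c st' v)"
        using Cons.prems st by (intro Cons.IH[OF ok]) auto
      then show ?thesis using a Y True st Cons.prems by (auto simp: stack_output_pop)
    next
      case False
      have "stack_output (Suc c) st' (map fst (run_stack (Suc c) st' v)) \<and>
          marking (Suc c) (Suc t) (run_stack (Suc c) st' v)"
        using Cons.prems st by (intro Cons.IH[OF ok]) (auto simp: less_Suc_eq)
      then show ?thesis using a Y False st Cons.prems
        by (auto simp: stack_output_pop stack_output_push_pop less_Suc_eq)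
    qed
  next
    case Z
    have "stack_output (Suc c) st (map fst (run_stack (Suc c) st v)) \<and>
        marking (Suc c) (t - 1) (run_stack (Suc c) st v)"
      using Cons.prems a Z by (intro Cons.IH) (auto simp: less_Suc_eq)
    then show ?thesis using a Z Cons.prems by (auto simp: stack_output_push_pop)
  qed
qed simp

text \<open>The first output reveals the first letter: a value above \<open>c\<close> means X, a
  marked \<open>c\<close> means Z, an unmarked \<open>c\<close> means Y, and a value below
  \<open>c\<close> means an underlined Y.\<close>

lemma run_stack_inj:
  assumes "duck_suffix x (length st) t v" "duck_suffix x' (length st) t v'"
    and "sorted_wrt (>) st" "\<forall>y\<in>set st. y < c" "run_stack c st v = run_stack c st v'"
  shows "v = v'"
  using assms
proof (induction v arbitrary: x x' t c st v')
  case Nil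
  show ?case
  proof (cases v')
    case (Cons b w)
    obtain z u where "b = (z, u)" by force
    \<comment> \<open>Every letter but X outputs something at once, and after an X something must
      still be output.\<close>
    then show ?thesis using Nil Cons run_stack_after_X[of 1 t w "Suc c" "[c]"]
      by (cases z) auto
  qed simp
next
  case (Cons a v)
  obtain z u where a: "a = (z, u)" by force
  show ?case
  proof (cases v')
    case Nil
    then show ?thesis
      using Cons.prems a run_stack_after_X[of 1 t v "Suc c" "[c]"] by (cases z) auto
  next
    case v': (Cons b w)
    obtain z' u' where b: "b = (z', u')" by force
    note X1 = run_stack_after_X[of "Suc (length st)" t v "Suc c" "c # st"]
    note X2 = run_stack_after_X[of "Suc (length st)" t w "Suc c" "c # st"]
    show ?thesis
    proof (cases "z = X")
      case True
      have "z' = X"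
        using Cons.prems X1 a b v' True
        by (cases z'; cases st) (auto split: if_splits)
      moreover have "v = w"
        using Cons.prems a b v' True \<open>z' = X\<close>
        by (intro Cons.IH[of True "c # st" t True w "Suc c"]) (auto simp: less_Suc_eq)
      ultimately show ?thesis using a b v' True Cons.prems by auto
    next
      case False
      have "z' \<noteq> X"
        using Cons.prems X2 a b v' False
        by (cases z; cases st) (auto split: if_splits)
      with False have z: "z = z' \<and> u = u'"
        using Cons.prems a b v'
        by (cases z; cases z'; cases st) (auto split: if_splits)
      have "v = w"
      proof (cases "z = Z")
        case True
        then show ?thesis using Cons.prems a b v' z
          by (intro Cons.IH[of False st "t - 1" False w "Suc c"]) (auto simp: less_Suc_eq)
      next
        case nZ: False
        then have zY: "z = Y" using False by (cases z) auto
        then obtain y st' where st: "st = y # st'" using Cons.prems a by (cases st) auto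
        \<comment> \<open>An underlined Y only pops, so the counter stays; any other Y also pushes
          \<open>c\<close>.\<close>
        show ?thesis using Cons.prems a b v' z zY st
          by (intro Cons.IH[of False st' "Suc t" False w "if u then c else Suc c"])
            (auto simp: less_Suc_eq)
      qed
      then show ?thesis using a b v' z by simp
    qed
  qed
qed

text \<open>The word is read off from the front of \<open>l\<close>. The induction on the length is
  strong because a Y that is not underlined consumes two outputs.\<close>

lemma run_stack_surj:
  assumes "stack_output c st (map fst l)" "marking c t l" "x \<longrightarrow> l \<noteq> [] \<and> c \<le> fst (hd l)"
  shows "\<exists>v. duck_suffix x (length st) t v \<and> run_stack c st v = l"
  using assms
proof (induction "length l" arbitrary: l c st t x rule: less_induct)
  case (less l)
  show ?case
  proof (cases l)
    case Nil
    then show ?thesis using less.prems by (intro exI[of _ "[]"]) auto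
  next
    case l: (Cons a r)
    obtain h e where a: "a = (h, e)" by force
    show ?thesis
    proof (cases "h < c")
      case True
      then obtain st' where st: "st = h # st'" "stack_output c st' (map fst r)"
        using less.prems(1) l a by (auto simp: stack_output_pop)
      obtain v where "duck_suffix False (length st') (Suc t) v" "run_stack c st' v = r"
        using less.hyps[of r c st' "Suc t" False] st less.prems l a True by auto
      then show ?thesis using st less.prems l a True by (intro exI[of _ "(Y, True) # v"]) auto
    next
      case False
      \<comment> \<open>An X consumes no output, so the missing pushes are supplied by an inner
        induction on the gap \<open>d\<close> between \<open>c\<close> and the head.\<close>
      have "\<exists>v. duck_suffix y (length st) t v \<and> run_stack c st v = l"
        if "h = c + d" "stack_output c st (map fst l)" "marking c t l" for d c st y
        using that
      proof (induction d arbitrary: c st y)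
        case 0
        have out: "stack_output (Suc c) st (map fst r)" using 0 l a by (simp add: stack_output_push_pop)
        show ?case
        proof (cases e)
          case True
          obtain v where "duck_suffix False (length st) (t - 1) v" "run_stack (Suc c) st v = r"
            using less.hyps[of r "Suc c" st "t - 1" False] out 0 l a True by auto
          then show ?thesis using 0 l a True by (intro exI[of _ "(Z, False) # v"]) auto
        next
          case False
          \<comment> \<open>An unmarked maximum is followed by a descent bottom, and one Y outputs
            both.\<close>
          then obtain h' e' r' where r: "r = (h', e') # r'" "h' < Suc c"
            using 0 l a by (cases r) (auto split: if_splits)
          then obtain st' where st: "st = h' # st'" "stack_output (Suc c) st' (map fst r')"
            using out by (auto simp: stack_output_pop)
          obtain v where "duck_suffix False (length st') (Suc t) v" "run_stack (Suc c) st' v = r'"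
            using less.hyps[of r' "Suc c" st' "Suc t" False] st r 0 l a False by auto
          then show ?thesis using st r 0 l a False by (intro exI[of _ "(Y, False) # v"]) auto
        qed
      next
        case (Suc d)
        have "stack_output (Suc c) (c # st) (map fst l)"
          using Suc.prems l a by (simp add: stack_output_push[symmetric])
        moreover have "marking (Suc c) t l" using Suc.prems l a by simp
        ultimately obtain v where "duck_suffix True (length (c # st)) t v" "run_stack (Suc c) (c # st) v = l"
          using Suc.IH[of "Suc c" "c # st" True] Suc.prems by auto
        then show ?case using Suc.prems by (intro exI[of _ "(X, False) # v"]) auto
      qed
      from this[of c "h - c" st x] show ?thesis using False less.prems by auto
    qed
  qed
qed

text \<open>An X outputs nothing, a Z or an underlined Y one entry, any other Y two;
  \<open>duck_suffix\<close> confines underlining to Y's. With \<open>k\<close> letters of each kind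
  and \<open>i\<close> underlinings the output has length \<open>3 * k - i\<close>.\<close>

lemma length_run_stack:
  "duck_suffix x s t v \<Longrightarrow>
     length (run_stack c st v) + length (filter snd v) =
     2 * count_list (map fst v) Y + count_list (map fst v) Z"
proof (induction v arbitrary: x s t c st)
  case (Cons a v)
  obtain z u where "a = (z, u)" by force
  then show ?case using Cons by (cases z) fastforce+
qed simp

lemma length_marks_run_stack:
  "length (filter snd (run_stack c st v)) = count_list (map fst v) Z"
proof (induction v arbitrary: c st)
  case (Cons a v)
  obtain z u where "a = (z, u)" by force
  then show ?case using Cons by (cases z) auto
qed simp

subsection \<open>Avoidance and descent bottoms\<close>

lemma all_less_Suc_shift: "(\<forall>p<Suc n. P p) \<longleftrightarrow> P 0 \<and> (\<forall>p<n. P (Suc p))"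
  by (auto simp: less_Suc_eq_0_disj)

lemma all_le_Suc_shift: "(\<forall>p\<le>Suc n. P p) \<longleftrightarrow> P 0 \<and> (\<forall>p\<le>n. P (Suc p))"
  using all_less_Suc_shift[of "Suc n" P] by (simp only: less_Suc_eq_le)

lemma ex_less_Suc_shift: "(\<exists>p<Suc n. P p) \<longleftrightarrow> P 0 \<or> (\<exists>p<n. P (Suc p))"
  by (auto simp: less_Suc_eq_0_disj)

lemma card_less_Suc_shift:
  "card {p. p < Suc n \<and> P p} = (if P 0 then 1 else 0) + card {p. p < n \<and> P (Suc p)}"
proof -
  have "{p. p < Suc n \<and> P p} = (if P 0 then {0} else {}) \<union> Suc ` {p. p < n \<and> P (Suc p)}"
    by (auto simp: less_Suc_eq_0_disj)
  then show ?thesis by (auto simp: card_insert_if card_image)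
qed

lemma sorted_wrt_filter_nth:
  "sorted_wrt R (filter P xs) \<longleftrightarrow>
     (\<forall>c<length xs. \<forall>b<c. P (xs ! b) \<longrightarrow> P (xs ! c) \<longrightarrow> R (xs ! b) (xs ! c))"
  by (induction xs) (auto simp: all_less_Suc_shift in_set_conv_nth)

lemma avoids_312_iff_nth:
  "avoids_312 \<pi> \<longleftrightarrow>
     (\<forall>c<length \<pi>. \<forall>b<c. \<forall>a<b. \<not> (\<pi> ! b < \<pi> ! c \<and> \<pi> ! c < \<pi> ! a))"
proof -
  have "(\<exists>a b c. 1 \<le> a \<and> a < b \<and> b < c \<and> c \<le> length \<pi> \<and>
            entry \<pi> b < entry \<pi> c \<and> entry \<pi> c < entry \<pi> a) \<longleftrightarrow>
        (\<exists>a b c. a < b \<and> b < c \<and> c < length \<pi> \<and> \<pi> ! b < \<pi> ! c \<and> \<pi> ! c < \<pi> ! a)"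
    (is "?L \<longleftrightarrow> ?R")
  proof
    assume ?L
    then obtain a b c where "1 \<le> a" "a < b" "b < c" "c \<le> length \<pi>"
      "entry \<pi> b < entry \<pi> c" "entry \<pi> c < entry \<pi> a" by blast
    then show ?R
      by (intro exI[of _ "a - 1"] exI[of _ "b - 1"] exI[of _ "c - 1"]) (auto simp: entry_def)
  next
    assume ?R
    then obtain a b c where "a < b" "b < c" "c < length \<pi>" "\<pi> ! b < \<pi> ! c" "\<pi> ! c < \<pi> ! a"
      by blast
    then show ?L
      by (intro exI[of _ "Suc a"] exI[of _ "Suc b"] exI[of _ "Suc c"]) (auto simp: entry_def)
  qed
  then show ?thesis unfolding avoids_312_def by blast
qed

text \<open>A pattern either uses the head as its 3 or lies in the tail. Distinctness turns the
  absence of an increasing pair among the smaller entries into strict decrease.\<close>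

lemma av312_iff_avoids_312: "distinct \<pi> \<Longrightarrow> av312 \<pi> \<longleftrightarrow> avoids_312 \<pi>"
proof (induction \<pi>)
  case Nil
  show ?case by (simp add: avoids_312_iff_nth)
next
  case (Cons h \<sigma>)
  have "sorted_wrt (>) (filter (\<lambda>x. x < h) \<sigma>) \<longleftrightarrow>
      (\<forall>c<length \<sigma>. \<forall>b<c. \<not> (\<sigma> ! b < \<sigma> ! c \<and> \<sigma> ! c < h))" (is "_ \<longleftrightarrow> ?R")
  proof -
    have "\<sigma> ! b \<noteq> \<sigma> ! c" if "b < c" "c < length \<sigma>" for b c
      using Cons.prems that by (auto simp: nth_eq_iff_index_eq)
    then show ?thesis unfolding sorted_wrt_filter_nth
      by (meson less_trans linorder_neqE_nat not_less_iff_gr_or_eq)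
  qed
  moreover have "avoids_312 (h # \<sigma>) \<longleftrightarrow> ?R \<and> avoids_312 \<sigma>"
    unfolding avoids_312_iff_nth by (auto simp: all_less_Suc_shift)
  ultimately show ?case using Cons by simp
qed

text \<open>When nothing has been pushed yet, the output has value set \<open>{1..<m}\<close>, and
  the length forces \<open>m = Suc n\<close>.\<close>

lemma Av_312_iff_stack_output:
  "\<pi> \<in> Av_312 n \<longleftrightarrow> stack_output 1 [] \<pi> \<and> length \<pi> = n"
proof
  assume "\<pi> \<in> Av_312 n"
  then have \<pi>: "set \<pi> = {1..n}" "distinct \<pi>" "avoids_312 \<pi>"
    by (auto simp: Av_312_def dest: permutations_of_setD)
  have "av312 \<pi>" using \<pi>(2,3) by (simp add: av312_iff_avoids_312)
  moreover have "filter (\<lambda>x. x < 1) \<pi> = []" using \<pi>(1) by (simp add: filter_empty_conv)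
  moreover have "set \<pi> = set [] \<union> {1..<Suc n}"
    using \<pi>(1) by (simp only: list.set(1) Un_empty_left atLeastLessThanSuc_atLeastAtMost)
  ultimately have "stack_output 1 [] \<pi>"
    using \<pi>(2) by (intro stack_outputI[of _ _ "Suc n"]) simp_all
  moreover have "length \<pi> = n" using distinct_card[OF \<pi>(2)] \<pi>(1) by simp
  ultimately show "stack_output 1 [] \<pi> \<and> length \<pi> = n" ..
next
  assume R: "stack_output 1 [] \<pi> \<and> length \<pi> = n"
  then have "stack_output 1 [] \<pi>" by simp
  then obtain m where m: "1 \<le> m" "set \<pi> = set [] \<union> {1..<m}" "distinct \<pi>" "av312 \<pi>"
    by (rule stack_outputE)
  have "m = Suc n" using distinct_card[OF m(3)] m(1,2) R by simp
  then have "set \<pi> = {1..n}"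
    using m(2) by (simp only: list.set(1) Un_empty_left atLeastLessThanSuc_atLeastAtMost)
  moreover have "avoids_312 \<pi>" using m(3,4) by (simp add: av312_iff_avoids_312)
  ultimately show "\<pi> \<in> Av_312 n"
    using permutations_of_setI[of \<pi> "{1..n}"] m(3) by (simp add: Av_312_def)
qed

section \<open>The marking condition in terms of positions\<close>

text \<open>The positional form of the test \<open>h < c\<close> made by \<open>marking\<close>. The
  second disjunct is weak because passing an entry \<open>h\<close> raises the counter to at least
  \<open>Suc h\<close>.\<close>

definition bottom :: "nat \<Rightarrow> (nat \<times> bool) list \<Rightarrow> nat \<Rightarrow> bool" where
  "bottom c l p \<longleftrightarrow> fst (l ! p) < c \<or> (\<exists>q<p. fst (l ! p) \<le> fst (l ! q))"

lemma bottom_0: "bottom c ((h, e) # l) 0 \<longleftrightarrow> h < c"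
  by (simp add: bottom_def)

lemma bottom_Suc: "bottom c ((h, e) # l) (Suc p) \<longleftrightarrow> bottom (max c (Suc h)) l p"
  by (auto simp: bottom_def ex_less_Suc_shift)

text \<open>The counter of \<open>marking\<close> is \<open>t\<close> plus the bottoms minus the
  marks passed so far. It never becomes negative and ends at 0, which gives the last two
  conditions.\<close>

lemma marking_iff:
  "marking c t l \<longleftrightarrow>
     (\<forall>p<length l. bottom c l p \<longrightarrow> \<not> snd (l ! p)) \<and>
     (\<forall>p<length l. bottom c l p \<or> snd (l ! p) \<or> Suc p < length l \<and> bottom c l (Suc p)) \<and>
     (\<forall>q\<le>length l. card {p. p < q \<and> snd (l ! p)} \<le> t + card {p. p < q \<and> bottom c l p}) \<and>
     card {p. p < length l \<and> snd (l ! p)} = t + card {p. p < length l \<and> bottom c l p}"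
proof (induction l arbitrary: c t)
  case (Cons a l)
  obtain h e where a: "a = (h, e)" by force
  note simps = all_less_Suc_shift all_le_Suc_shift card_less_Suc_shift bottom_0 bottom_Suc a
  show ?case
  proof (cases "h < c")
    case True
    then have "max c (Suc h) = c" by simp
    with True show ?thesis by (simp add: simps Cons.IH)
  next
    case False
    then have max: "max c (Suc h) = Suc h" by simp
    have hd: "l \<noteq> [] \<and> fst (hd l) \<le> h \<longleftrightarrow> 0 < length l \<and> bottom (Suc h) l 0"
      by (cases l) (auto simp: bottom_def less_Suc_eq_le)
    show ?thesis
    proof (cases e)
      case True
      \<comment> \<open>The ballot inequality at the empty prefix of the tail already demands an
        unfinished hook.\<close>
      have pos: "0 < t" if "\<forall>q\<le>length l. Suc (card {p. p < q \<and> snd (l ! p)})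
          \<le> t + card {p. p < q \<and> bottom (Suc h) l p}"
        using spec[OF that, of 0] by simp
      show ?thesis
      proof (cases t)
        case 0
        then show ?thesis using False True pos by (auto simp: simps max)
      next
        case (Suc t')
        then show ?thesis using False True by (simp add: simps max Cons.IH)
      qed
    next
      case e: False
      show ?thesis using False e hd by (simp add: simps max Cons.IH) blast
    qed
  qed
qed simp

subsection \<open>Noncrossing matchings\<close>

text \<open>The strict \<open>i' < j\<close> allows an arc to begin where another one ends, as is
  allowed for hooks.\<close>

definition noncrossing_matching :: "nat set \<Rightarrow> nat set \<Rightarrow> (nat \<times> nat) set \<Rightarrow> bool" where
  "noncrossing_matching A N H \<longleftrightarrow>
     fst ` H = A \<and> snd ` H = N \<and> inj_on fst H \<and> inj_on snd H \<and> (\<forall>(i, j) \<in> H. i < j) \<and>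
     (\<forall>(i, j) \<in> H. \<forall>(i', j') \<in> H. \<not> (i < i' \<and> i' < j \<and> j < j'))"

text \<open>An arc that ends by \<open>q\<close> starts before \<open>q\<close>, and both
  projections are injective.\<close>

lemma noncrossing_matching_ballot:
  assumes "noncrossing_matching A N H" "finite A"
  shows "card {j \<in> N. j \<le> q} \<le> card {i \<in> A. i < q}" and "card N = card A"
proof -
  have H: "fst ` H = A" "snd ` H = N" "inj_on fst H" "inj_on snd H" "\<And>i j. (i, j) \<in> H \<Longrightarrow> i < j"
    using assms(1) by (auto simp: noncrossing_matching_def)
  let ?H = "{h \<in> H. snd h \<le> q}"
  have "card {j \<in> N. j \<le> q} = card (snd ` ?H)"
    using H(2) by (intro arg_cong[of _ _ card]) auto
  also have "\<dots> = card ?H" using H(4) by (intro card_image) (auto intro: inj_on_subset)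
  also have "\<dots> = card (fst ` ?H)" using H(3) by (intro card_image[symmetric]) (auto intro: inj_on_subset)
  also have "\<dots> \<le> card {i \<in> A. i < q}"
  proof (rule card_mono)
    show "fst ` ?H \<subseteq> {i \<in> A. i < q}"
    proof
      fix i assume "i \<in> fst ` ?H"
      then obtain j where "(i, j) \<in> H" "j \<le> q" by auto
      moreover from this have "i < j" by (simp add: H(5))
      ultimately show "i \<in> {i \<in> A. i < q}" using H(1) by force
    qed
  qed (use assms(2) in simp)
  finally show "card {j \<in> N. j \<le> q} \<le> card {i \<in> A. i < q}" .
  show "card N = card A" using H card_image by metis
qed

text \<open>If the least right end \<open>j\<close> were matched to some \<open>i'\<close> before
  \<open>i\<close>, the arc from \<open>i\<close> would have to end after \<open>j\<close>, and the
  two arcs would cross.\<close>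

lemma noncrossing_matching_forced:
  assumes H: "noncrossing_matching A N H" and j: "j \<in> N" "\<forall>j'\<in>N. j \<le> j'"
    and i: "i \<in> A" "i < j" "\<forall>i'\<in>A. i' < j \<longrightarrow> i' \<le> i"
  shows "(i, j) \<in> H"
proof -
  obtain j' where j': "(i, j') \<in> H" using H i(1) by (auto simp: noncrossing_matching_def)
  obtain i' where i': "(i', j) \<in> H" using H j(1) by (auto simp: noncrossing_matching_def)
  have "j \<le> j'" using H j(2) j' by (force simp: noncrossing_matching_def)
  have "i' < j" using H i' by (auto simp: noncrossing_matching_def)
  have "i' \<le> i" using H i(3) i' \<open>i' < j\<close> by (force simp: noncrossing_matching_def)
  have nc: "\<not> (i' < i \<and> i < j \<and> j < j')"
    using H i' j' unfolding noncrossing_matching_def by blast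
  show ?thesis
  proof (cases "j = j'")
    case False
    then have "i' = i" using nc \<open>j \<le> j'\<close> \<open>i' \<le> i\<close> i(2) by auto
    then show ?thesis using i' by simp
  qed (use j' in simp)
qed

lemma noncrossing_matching_remove:
  assumes H: "noncrossing_matching A N H" and ij: "(i, j) \<in> H"
  shows "noncrossing_matching (A - {i}) (N - {j}) (H - {(i, j)})"
proof -
  have inj: "inj_on fst H" "inj_on snd H"
    using H by (auto simp: noncrossing_matching_def)
  have "fst ` (H - {(i, j)}) = fst ` H - {i}" "snd ` (H - {(i, j)}) = snd ` H - {j}"
    using inj_on_image_set_diff[OF inj(1) Diff_subset, of "{(i, j)}"]
      inj_on_image_set_diff[OF inj(2) Diff_subset, of "{(i, j)}"] ij
    by simp_all
  with H inj show ?thesis unfolding noncrossing_matching_def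
    by (simp add: inj_on_diff) blast
qed

text \<open>No left end lies between \<open>i\<close> and \<open>j\<close> and no right end before
  \<open>j\<close>, so the new arc crosses no other.\<close>

lemma noncrossing_matching_insert:
  assumes H: "noncrossing_matching (A - {i}) (N - {j}) H" and j: "j \<in> N" "\<forall>j'\<in>N. j \<le> j'"
    and i: "i \<in> A" "i < j" "\<forall>i'\<in>A. i' < j \<longrightarrow> i' \<le> i"
  shows "noncrossing_matching A N (insert (i, j) H)"
proof -
  have in_H: "a \<in> A \<and> a \<noteq> i \<and> b \<in> N \<and> b \<noteq> j" if "(a, b) \<in> H" for a b
  proof -
    have "a \<in> fst ` H" "b \<in> snd ` H" using that by force+
    then show ?thesis using H by (simp add: noncrossing_matching_def)
  qed
  have "(i, j) \<notin> H" using in_H by blast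
  have "fst ` insert (i, j) H = A" "snd ` insert (i, j) H = N"
    using H i(1) j(1) by (simp_all add: noncrossing_matching_def insert_absorb)
  moreover have "inj_on fst (insert (i, j) H)" "inj_on snd (insert (i, j) H)"
    using H \<open>(i, j) \<notin> H\<close> by (simp_all add: noncrossing_matching_def)
  moreover have "\<forall>(i, j) \<in> insert (i, j) H. i < j"
    using H i(2) by (simp add: noncrossing_matching_def)
  moreover have "\<not> (a < a' \<and> a' < b \<and> b < b')"
    if ab: "(a, b) \<in> insert (i, j) H" "(a', b') \<in> insert (i, j) H" for a b a' b'
  proof -
    consider "(a, b) = (i, j)" "(a', b') = (i, j)" | "(a, b) = (i, j)" "(a', b') \<in> H"
      | "(a, b) \<in> H" "(a', b') = (i, j)" | "(a, b) \<in> H" "(a', b') \<in> H"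
      using ab by blast
    then show ?thesis
    proof cases
      case 2
      then have "a' < j \<longrightarrow> a' \<le> i" using in_H i(3) by blast
      then show ?thesis using 2 by auto
    next
      case 3
      then have "j \<le> b" using in_H j(2) by blast
      then show ?thesis using 3 by auto
    next
      case 4
      then show ?thesis using H unfolding noncrossing_matching_def by blast
    qed simp
  qed
  ultimately show ?thesis unfolding noncrossing_matching_def by blast
qed

text \<open>The arc to the least right end from the last left end before it is forced; removing it
  leaves a smaller problem of the same kind.\<close>

lemma noncrossing_matching_exists_unique:
  assumes "finite A" "finite N" "card N = card A"
    and "\<And>q. card {j \<in> N. j \<le> q} \<le> card {i \<in> A. i < q}"
  shows "\<exists>!H. noncrossing_matching A N H"
  using assms
proof (induction "card N" arbitrary: A N)
  case 0
  then show ?case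
    by (intro ex1I[of _ "{}"]) (auto simp: noncrossing_matching_def)
next
  case (Suc k)
  define j where "j = Min N"
  have ne: "N \<noteq> {}" using Suc.hyps by auto
  have j: "j \<in> N" "\<forall>j'\<in>N. j \<le> j'" using Suc.prems ne by (auto simp: j_def)
  \<comment> \<open>The ballot condition at \<open>j\<close> provides a left end before
    \<open>j\<close>.\<close>
  have "card {j} \<le> card {j' \<in> N. j' \<le> j}" using j Suc.prems by (intro card_mono) auto
  also have "\<dots> \<le> card {i \<in> A. i < j}" by (rule Suc.prems)
  finally have "0 < card {i \<in> A. i < j}" by simp
  then have below: "{i \<in> A. i < j} \<noteq> {}" by (metis card.empty less_irrefl)
  define i where "i = Max {i \<in> A. i < j}"
  have "i \<in> {i \<in> A. i < j}" unfolding i_def using below Suc.prems by (intro Max_in) auto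
  then have i: "i \<in> A" "i < j" "\<forall>i'\<in>A. i' < j \<longrightarrow> i' \<le> i"
    using Suc.prems by (auto simp: i_def)
  \<comment> \<open>From \<open>j\<close> on both counts drop by one; before \<open>j\<close> there
    is no right end.\<close>
  have ballot: "card {j' \<in> N - {j}. j' \<le> q} \<le> card {i' \<in> A - {i}. i' < q}" for q
  proof (cases "j \<le> q")
    case True
    have "{j' \<in> N - {j}. j' \<le> q} = {j' \<in> N. j' \<le> q} - {j}"
      "{i' \<in> A - {i}. i' < q} = {i' \<in> A. i' < q} - {i}" by auto
    moreover have "j \<in> {j' \<in> N. j' \<le> q}" "i \<in> {i' \<in> A. i' < q}" using True i j by auto
    ultimately show ?thesis
      using Suc.prems(4)[of q] by (simp add: card_Diff_singleton diff_le_mono)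
  next
    case False
    then have "{j' \<in> N - {j}. j' \<le> q} = {}" using j by auto
    then show ?thesis by (simp only: card.empty le0)
  qed
  have "\<exists>!H. noncrossing_matching (A - {i}) (N - {j}) H"
  proof (rule Suc.hyps(1))
    show "k = card (N - {j})" using Suc.hyps(2) j(1) by (simp add: card_Diff_singleton)
    show "card (N - {j}) = card (A - {i})"
      using Suc.prems(3) i(1) j(1) by (simp add: card_Diff_singleton)
      show "finite (A - {i})" "finite (N - {j})" using Suc.prems(1,2) by simp_all
  qed (rule ballot)
  then obtain H where H: "noncrossing_matching (A - {i}) (N - {j}) H"
    and uniq: "\<And>H'. noncrossing_matching (A - {i}) (N - {j}) H' \<Longrightarrow> H' = H" by blast
  show ?case
  proof (rule ex1I)
    show "noncrossing_matching A N (insert (i, j) H)"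
      by (rule noncrossing_matching_insert[OF H j i])
  next
    fix H' assume H': "noncrossing_matching A N H'"
    have ij: "(i, j) \<in> H'" by (rule noncrossing_matching_forced[OF H' j i])
    then show "H' = insert (i, j) H" using uniq[OF noncrossing_matching_remove[OF H' ij]] insert_Diff by metis
  qed
qed

subsection \<open>Valid hook configurations on 312-avoiding permutations\<close>

lemma point_eq_iff [simp]: "point \<pi> i = point \<pi> j \<longleftrightarrow> i = j"
  by (auto simp: point_def)

lemma Av_312_facts:
  assumes "\<pi> \<in> Av_312 n"
  shows "length \<pi> = n" "distinct \<pi>" "set \<pi> = {1..n}" "avoids_312 \<pi>"
    and "\<And>i j. \<lbrakk>1 \<le> i; i \<le> n; 1 \<le> j; j \<le> n\<rbrakk> \<Longrightarrow> entry \<pi> i = entry \<pi> j \<longleftrightarrow> i = j"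
proof -
  show len: "length \<pi> = n" using assms by (simp add: Av_312_iff_stack_output)
  show dist: "distinct \<pi>" "set \<pi> = {1..n}" "avoids_312 \<pi>"
    using assms permutations_of_setD[of \<pi> "{1..n}"] by (simp_all add: Av_312_def)
  show "entry \<pi> i = entry \<pi> j \<longleftrightarrow> i = j" if "1 \<le> i" "i \<le> n" "1 \<le> j" "j \<le> n" for i j
    using that len dist(1) by (auto simp: entry_def nth_eq_iff_index_eq)
qed

lemma descents_bounds: "i \<in> descents \<pi> \<Longrightarrow> 1 \<le> i \<and> i < length \<pi>"
  by (simp add: descents_def)

lemma finite_descents: "finite (descents \<pi>)"
  by (rule finite_subset[of _ "{..<length \<pi>}"]) (auto simp: descents_def)

text \<open>If \<open>j\<close> is no descent bottom but some larger entry stands before it, then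
  the entry just before \<open>j\<close> is smaller, and the three form a 312 pattern.\<close>

lemma not_descent_bottom_iff:
  assumes "\<pi> \<in> Av_312 n" "1 \<le> j" "j \<le> n"
  shows "j \<notin> Suc ` descents \<pi> \<longleftrightarrow> (\<forall>l. 1 \<le> l \<and> l < j \<longrightarrow> entry \<pi> l < entry \<pi> j)"
proof
  note facts = Av_312_facts[OF assms(1)]
  assume nd: "j \<notin> Suc ` descents \<pi>"
  show "\<forall>l. 1 \<le> l \<and> l < j \<longrightarrow> entry \<pi> l < entry \<pi> j"
  proof (intro allI impI)
    fix l assume l: "1 \<le> l \<and> l < j"
    show "entry \<pi> l < entry \<pi> j"
    proof (rule ccontr)
      assume "\<not> entry \<pi> l < entry \<pi> j"
      moreover have "entry \<pi> l \<noteq> entry \<pi> j" using facts(5)[of l j] l assms by simp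
      ultimately have gt: "entry \<pi> j < entry \<pi> l" by simp
      obtain i where j: "j = Suc i" using assms(2) by (cases j) auto
      have "i \<notin> descents \<pi>" using nd j by blast
      moreover have "entry \<pi> i \<noteq> entry \<pi> j" if "1 \<le> i" using facts(5)[of i j] j assms that by simp
      ultimately have lt: "entry \<pi> i < entry \<pi> j"
        using l j assms facts(1) by (auto simp: descents_def)
      then have "l < i" using gt l j by (metis less_SucE less_asym)
      moreover have "\<not> (1 \<le> l \<and> l < i \<and> i < j \<and> j \<le> length \<pi> \<and>
          entry \<pi> i < entry \<pi> j \<and> entry \<pi> j < entry \<pi> l)"
        using facts(4) unfolding avoids_312_def by blast
      ultimately show False using gt lt l j assms facts(1) by simp
    qed
  qed
next
  assume R: "\<forall>l. 1 \<le> l \<and> l < j \<longrightarrow> entry \<pi> l < entry \<pi> j"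
  show "j \<notin> Suc ` descents \<pi>"
  proof
    assume "j \<in> Suc ` descents \<pi>"
    then obtain i where i: "j = Suc i" "i \<in> descents \<pi>" by blast
    then have "entry \<pi> i < entry \<pi> j" using R descents_bounds[OF i(2)] by simp
    then show False using i by (simp add: descents_def)
  qed
qed

section \<open>Intersections of hooks in the plane\<close>

lemma mem_hook_curve:
  assumes "i \<le> j" "entry \<pi> i \<le> entry \<pi> j"
  shows "(x, y) \<in> hook_curve \<pi> (i, j) \<longleftrightarrow>
    x = real i \<and> real (entry \<pi> i) \<le> y \<and> y \<le> real (entry \<pi> j) \<or>
    real i \<le> x \<and> x \<le> real j \<and> y = real (entry \<pi> j)"
  using assms unfolding hook_curve_def SW_def NE_def point_def
  by (auto simp: Let_def closed_segment_same_fst closed_segment_same_snd closed_segment_eq_real_ivl)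

text \<open>The horizontal part of the second hook lies above the whole first hook, so a common
  point is on its vertical part and on the horizontal part of the first. Noncrossing then leaves
  only \<open>i' = j\<close>.\<close>

lemma hook_curves_meet_at_endpoints:
  assumes ij: "i < j" "entry \<pi> i < entry \<pi> j" and ij': "i' < j'" "entry \<pi> i' < entry \<pi> j'"
    and lt: "j < j'" "entry \<pi> j < entry \<pi> j'" and ne: "i \<noteq> i'" and nc: "\<not> (i < i' \<and> i' < j)"
  shows "hook_curve \<pi> (i, j) \<inter> hook_curve \<pi> (i', j')
    \<subseteq> {SW \<pi> (i, j), NE \<pi> (i, j)} \<inter> {SW \<pi> (i', j'), NE \<pi> (i', j')}"
proof
  fix z assume z: "z \<in> hook_curve \<pi> (i, j) \<inter> hook_curve \<pi> (i', j')"
  obtain x y where xy: "z = (x, y)" by force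
  have m: "x = real i \<and> real (entry \<pi> i) \<le> y \<and> y \<le> real (entry \<pi> j) \<or>
      real i \<le> x \<and> x \<le> real j \<and> y = real (entry \<pi> j)"
    using z ij by (simp add: xy mem_hook_curve)
  have m': "x = real i' \<and> real (entry \<pi> i') \<le> y \<and> y \<le> real (entry \<pi> j') \<or>
      real i' \<le> x \<and> x \<le> real j' \<and> y = real (entry \<pi> j')"
    using z ij' by (simp add: xy mem_hook_curve)
  have "y < real (entry \<pi> j')" using m lt(2) by auto
  then have v: "x = real i'" "real (entry \<pi> i') \<le> y" using m' by auto
  then have h: "i \<le> i'" "i' \<le> j" "y = real (entry \<pi> j)" using m ne by auto
  then have "i' = j" using ne nc by auto
  then show "z \<in> {SW \<pi> (i, j), NE \<pi> (i, j)} \<inter> {SW \<pi> (i', j'), NE \<pi> (i', j')}"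
    using v h by (simp add: xy SW_def NE_def point_def)
qed

text \<open>Otherwise the vertical part of the second hook meets the horizontal part of the first at
  abscissa \<open>real i'\<close>, in a point that is no endpoint of the first. The weak
  inequalities cover hooks that share an endpoint.\<close>

lemma endpoints_noncrossing:
  assumes sub: "hook_curve \<pi> (i, j) \<inter> hook_curve \<pi> (i', j') \<subseteq> {SW \<pi> (i, j), NE \<pi> (i, j)}"
    and ij: "i < j" "entry \<pi> i < entry \<pi> j" and ij': "i' < j'" "entry \<pi> i' < entry \<pi> j'"
    and j: "j \<le> j'" "entry \<pi> j \<le> entry \<pi> j'"
  shows "\<not> (i \<le> i' \<and> i' < j \<and> entry \<pi> i' \<le> entry \<pi> j \<and> (i, j) \<noteq> (i', j'))"
proof
  assume H: "i \<le> i' \<and> i' < j \<and> entry \<pi> i' \<le> entry \<pi> j \<and> (i, j) \<noteq> (i', j')"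
  have "(real i', real (entry \<pi> j)) \<in> hook_curve \<pi> (i, j) \<inter> hook_curve \<pi> (i', j')"
    using H ij ij' j by (simp add: mem_hook_curve)
  then have "(real i', real (entry \<pi> j)) \<in> {SW \<pi> (i, j), NE \<pi> (i, j)}" using sub by blast
  then show False using H ij by (auto simp: SW_def NE_def point_def)
qed

lemma fst_image_eq_descents:
  "SW \<pi> ` H = descent_tops \<pi> \<longleftrightarrow> fst ` H = descents \<pi>"
proof -
  have "SW \<pi> ` H = point \<pi> ` fst ` H" by (simp add: SW_def image_image)
  then show ?thesis
    unfolding descent_tops_def by (simp add: inj_image_eq_iff inj_def)
qed

text \<open>Avoidance makes every NE endpoint a left-to-right maximum, so NE endpoints further right
  are higher. The intersection condition then depends only on positions.\<close>

lemma valid_hook_config_iff: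
  assumes \<pi>: "\<pi> \<in> Av_312 n"
  shows "valid_hook_config \<pi> H \<longleftrightarrow>
    noncrossing_matching (descents \<pi>) (snd ` H) H \<and> snd ` H \<subseteq> {1..n} - Suc ` descents \<pi>"
proof
  note facts = Av_312_facts[OF \<pi>]
  note bottom_iff = not_descent_bottom_iff[OF \<pi>]
  {
    assume V: "valid_hook_config \<pi> H"
    have hook: "1 \<le> i" "i < j" "j \<le> n" "entry \<pi> i < entry \<pi> j" if "(i, j) \<in> H" for i j
      using V that facts(1) by (auto simp: valid_hook_config_def hooks_def)
    have above: "entry \<pi> l \<le> entry \<pi> j" if "(i, j) \<in> H" "i < l" "l < j" for i j l
      using V that unfolding valid_hook_config_def by (metis (mono_tags, lifting) case_prodD not_le)
    have meet: "hook_curve \<pi> h \<inter> hook_curve \<pi> h' \<subseteq> {SW \<pi> h, NE \<pi> h} \<inter> {SW \<pi> h', NE \<pi> h'}"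
      if "h \<in> H" "h' \<in> H" "h \<noteq> h'" for h h'
      using V that unfolding valid_hook_config_def by blast
    have D: "fst ` H = descents \<pi>"
      using V by (simp add: valid_hook_config_def fst_image_eq_descents)
    \<comment> \<open>A larger entry left of \<open>i\<close> would complete a 312 pattern, and one
      between \<open>i\<close> and \<open>j\<close> would lie above the hook.\<close>
    have lrmax: "entry \<pi> l < entry \<pi> j" if "(i, j) \<in> H" "1 \<le> l" "l < j" for i j l
    proof -
      have "entry \<pi> l \<noteq> entry \<pi> j" using facts(5)[of l j] hook[OF that(1)] that by simp
      moreover have "entry \<pi> l \<le> entry \<pi> j" if "l < i"
      proof (rule ccontr)
        assume "\<not> entry \<pi> l \<le> entry \<pi> j"
        moreover have "\<not> (1 \<le> l \<and> l < i \<and> i < j \<and> j \<le> length \<pi> \<and>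
            entry \<pi> i < entry \<pi> j \<and> entry \<pi> j < entry \<pi> l)"
          using facts(4) unfolding avoids_312_def by blast
        ultimately show False
          using hook[OF \<open>(i, j) \<in> H\<close>] that \<open>1 \<le> l\<close> facts(1) by simp
      qed
      moreover have "entry \<pi> l \<le> entry \<pi> j" if "l = i" using hook[OF \<open>(i, j) \<in> H\<close>] that by simp
      moreover have "entry \<pi> l \<le> entry \<pi> j" if "i < l" using above that \<open>(i, j) \<in> H\<close> \<open>l < j\<close> by blast
      ultimately show ?thesis by (meson le_neq_implies_less linorder_neqE_nat)
    qed
    have mono: "entry \<pi> j \<le> entry \<pi> j'" if "(i, j) \<in> H" "(i', j') \<in> H" "j \<le> j'" for i j i' j'
      using lrmax[OF that(2), of j] hook[OF that(1)] that(3) by (cases "j = j'") auto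
    \<comment> \<open>The case \<open>i < i'\<close> gives noncrossing, \<open>i = i'\<close>
      injectivity of \<open>fst\<close>, and \<open>j = j'\<close> injectivity of
      \<open>snd\<close>.\<close>
    have key: "\<not> (i \<le> i' \<and> i' < j)" if "(i, j) \<in> H" "(i', j') \<in> H" "(i, j) \<noteq> (i', j')" "j \<le> j'"
      for i j i' j'
    proof -
      have "hook_curve \<pi> (i, j) \<inter> hook_curve \<pi> (i', j') \<subseteq> {SW \<pi> (i, j), NE \<pi> (i, j)}"
        using meet[OF that(1-3)] by simp
      from endpoints_noncrossing[OF this hook(2,4)[OF that(1)] hook(2,4)[OF that(2)]
          that(4) mono[OF that(1,2,4)]]
      show ?thesis using that(3) lrmax[OF that(1), of i'] hook(1)[OF that(2)] by auto
    qed
    have "inj_on fst H"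
    proof (rule inj_onI)
      fix h h' assume hh': "h \<in> H" "h' \<in> H" "fst h = fst h'"
      obtain i j i' j' where eq: "h = (i, j)" "h' = (i', j')" by force
      show "h = h'"
        using key[of i j i' j'] key[of i' j' i j] hook(2)[of i j] hook(2)[of i' j'] hh'
        unfolding eq by (cases "snd h \<le> snd h'") (auto simp: eq)
    qed
    moreover have "inj_on snd H"
    proof (rule inj_onI)
      fix h h' assume hh': "h \<in> H" "h' \<in> H" "snd h = snd h'"
      obtain i j i' j' where eq: "h = (i, j)" "h' = (i', j')" by force
      show "h = h'"
        using key[of i j i' j'] key[of i' j' i j] hook(2)[of i j] hook(2)[of i' j'] hh'
        unfolding eq by (cases "fst h \<le> fst h'") (auto simp: eq)
    qed
    moreover have "\<not> (i < i' \<and> i' < j \<and> j < j')" if "(i, j) \<in> H" "(i', j') \<in> H" for i j i' j'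
      using key[OF that] by auto
    moreover have "snd ` H \<subseteq> {1..n} - Suc ` descents \<pi>"
    proof
      fix j assume "j \<in> snd ` H"
      then obtain i where ij: "(i, j) \<in> H" by force
      then show "j \<in> {1..n} - Suc ` descents \<pi>"
        using hook[OF ij] bottom_iff[of j] lrmax[OF ij] by simp
    qed
    ultimately show "noncrossing_matching (descents \<pi>) (snd ` H) H \<and>
        snd ` H \<subseteq> {1..n} - Suc ` descents \<pi>"
      unfolding noncrossing_matching_def using D hook(2) by blast
  }
  {
    assume M: "noncrossing_matching (descents \<pi>) (snd ` H) H \<and>
      snd ` H \<subseteq> {1..n} - Suc ` descents \<pi>"
    then have D: "fst ` H = descents \<pi>" and inj: "inj_on fst H" "inj_on snd H"
      and less: "\<And>i j. (i, j) \<in> H \<Longrightarrow> i < j"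
      and nc: "\<And>i j i' j'. \<lbrakk>(i, j) \<in> H; (i', j') \<in> H\<rbrakk> \<Longrightarrow> \<not> (i < i' \<and> i' < j \<and> j < j')"
      unfolding noncrossing_matching_def by blast+
    have pos: "1 \<le> i" "j \<le> n" if "(i, j) \<in> H" for i j
    proof -
      have "i \<in> fst ` H" "j \<in> snd ` H" using that by force+
      then show "1 \<le> i" "j \<le> n" using M descents_bounds[of i \<pi>] unfolding D by auto
    qed
    have lrmax: "entry \<pi> l < entry \<pi> j" if "(i, j) \<in> H" "1 \<le> l" "l < j" for i j l
    proof -
      have "j \<in> snd ` H" using that(1) by force
      then have "j \<notin> Suc ` descents \<pi>" using M by blast
      then show ?thesis using bottom_iff[of j] that pos[OF that(1)] by auto
    qed
    have up: "entry \<pi> i < entry \<pi> j" if "(i, j) \<in> H" for i j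
      using lrmax[OF that] pos[OF that] less[OF that] by simp
    \<comment> \<open>Distinct hooks have distinct NE endpoints, so by symmetry
      \<open>j < j'\<close> may be assumed.\<close>
    have meet: "hook_curve \<pi> (i, j) \<inter> hook_curve \<pi> (i', j')
        \<subseteq> {SW \<pi> (i, j), NE \<pi> (i, j)} \<inter> {SW \<pi> (i', j'), NE \<pi> (i', j')}"
      if "(i, j) \<in> H" "(i', j') \<in> H" "(i, j) \<noteq> (i', j')" "j < j'" for i j i' j'
    proof (rule hook_curves_meet_at_endpoints)
      show "i \<noteq> i'" using inj_onD[OF inj(1) _ that(1,2)] that(3) by auto
      show "\<not> (i < i' \<and> i' < j)" using nc[OF that(1,2)] that(4) by blast
      show "entry \<pi> j < entry \<pi> j'"
        using lrmax[OF that(2), of j] pos[OF that(1)] less[OF that(1)] that(4) by simp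
    qed (use that less up in auto)
    have "hook_curve \<pi> h \<inter> hook_curve \<pi> h' \<subseteq> {SW \<pi> h, NE \<pi> h} \<inter> {SW \<pi> h', NE \<pi> h'}"
      if hh': "h \<in> H" "h' \<in> H" "h \<noteq> h'" for h h'
    proof -
      obtain i j i' j' where eq: "h = (i, j)" "h' = (i', j')" by force
      have "j \<noteq> j'" using inj_onD[OF inj(2) _ hh'(1,2)] hh'(3) eq by auto
      then consider "j < j'" | "j' < j" by linarith
      then show ?thesis
      proof cases
        case 1
        then show ?thesis using meet[of i j i' j'] hh' eq by blast
      next
        case 2
        then show ?thesis using meet[of i' j' i j] hh' eq by blast
      qed
    qed
    moreover have "H \<subseteq> hooks \<pi>"
      using pos less up facts(1) by (auto simp: hooks_def)
    moreover have "\<forall>(i, j) \<in> H. \<not> (\<exists>l. i < l \<and> l < j \<and> entry \<pi> l > entry \<pi> j)"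
    proof (clarify)
      fix i j l assume ij: "(i, j) \<in> H" and l: "i < l" "l < j" "entry \<pi> l > entry \<pi> j"
      have "entry \<pi> l < entry \<pi> j" using lrmax[OF ij] pos[OF ij] l by simp
      then show False using l by simp
    qed
    ultimately show "valid_hook_config \<pi> H"
      by (simp add: valid_hook_config_def fst_image_eq_descents D)
  }
qed

section \<open>Reduced configurations as marked words\<close>

lemma reduced_iff:
  assumes "length \<pi> = n" "fst ` H = descents \<pi>"
  shows "reduced \<pi> H \<longleftrightarrow> {1..n} \<subseteq> descents \<pi> \<union> snd ` H \<union> Suc ` descents \<pi>"
proof -
  have "SW \<pi> ` H \<union> NE \<pi> ` H \<union> descent_bottoms \<pi> =
      point \<pi> ` (descents \<pi> \<union> snd ` H \<union> Suc ` descents \<pi>)"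
    unfolding assms(2)[symmetric] descent_bottoms_def
    by (simp add: SW_def NE_def image_Un image_image)
  then show ?thesis
    unfolding reduced_def plot_def using assms(1) by (simp add: inj_image_subset_iff inj_def)
qed

text \<open>Index \<open>p\<close> is position \<open>Suc p\<close> of the permutation, and this is
  a descent bottom iff position \<open>p\<close> is a descent.\<close>

lemma bottom_iff_descent:
  assumes \<pi>: "\<pi> \<in> Av_312 n" and l: "map fst l = \<pi>" and p: "p < n"
  shows "bottom 1 l p \<longleftrightarrow> p \<in> descents \<pi>"
proof -
  note facts = Av_312_facts[OF \<pi>]
  have len: "length l = n" using facts(1) l by (metis length_map)
  have nth: "fst (l ! q) = \<pi> ! q" if "q < n" for q using that len by (simp flip: l)
  \<comment> \<open>All entries are at least 1, so the first disjunct of \<open>bottom 1 l p\<close>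
    is void.\<close>
  have "\<pi> ! p \<in> {1..n}" using facts(1,3) p nth_mem by metis
  then have "bottom 1 l p \<longleftrightarrow> (\<exists>q<p. \<pi> ! p \<le> \<pi> ! q)"
    using nth p by (auto simp: bottom_def)
  also have "\<dots> \<longleftrightarrow> \<not> (\<forall>l. 1 \<le> l \<and> l < Suc p \<longrightarrow> entry \<pi> l < entry \<pi> (Suc p))"
  proof -
    have "(\<forall>l. 1 \<le> l \<and> l < Suc p \<longrightarrow> entry \<pi> l < entry \<pi> (Suc p)) \<longleftrightarrow> (\<forall>q<p. \<pi> ! q < \<pi> ! p)"
    proof safe
      fix q assume "\<forall>l. 1 \<le> l \<and> l < Suc p \<longrightarrow> entry \<pi> l < entry \<pi> (Suc p)" "q < p"
      then show "\<pi> ! q < \<pi> ! p" by (auto simp: entry_def dest!: spec[of _ "Suc q"])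
    next
      fix l assume "\<forall>q<p. \<pi> ! q < \<pi> ! p" "1 \<le> l" "l < Suc p"
      then show "entry \<pi> l < entry \<pi> (Suc p)" by (auto simp: entry_def dest!: spec[of _ "l - 1"])
    qed
    then show ?thesis by (simp add: not_less)
  qed
  also have "\<dots> \<longleftrightarrow> p \<in> descents \<pi>"
  proof -
    have "Suc p \<notin> Suc ` descents \<pi> \<longleftrightarrow> (\<forall>l. 1 \<le> l \<and> l < Suc p \<longrightarrow> entry \<pi> l < entry \<pi> (Suc p))"
      by (rule not_descent_bottom_iff[OF \<pi>]) (use p in simp_all)
    then show ?thesis by (metis (no_types, lifting) image_iff nat.inject)
  qed
  finally show ?thesis .
qed

text \<open>Indices below \<open>q\<close> are positions up to \<open>q\<close>, hence
  \<open>j \<le> q\<close> for NE endpoints. A bottom at index \<open>i\<close> is a descent at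
  position \<open>i\<close>, hence \<open>i < q\<close>.\<close>

lemma marking_iff_ballot:
  assumes \<pi>: "\<pi> \<in> Av_312 n" and l: "map fst l = \<pi>"
    and N: "N \<subseteq> {1..n}" "\<forall>p<n. snd (l ! p) \<longleftrightarrow> Suc p \<in> N"
  shows "marking 1 0 l \<longleftrightarrow>
    N \<subseteq> {1..n} - Suc ` descents \<pi> \<and> {1..n} \<subseteq> descents \<pi> \<union> N \<union> Suc ` descents \<pi> \<and>
    (\<forall>q. card {j \<in> N. j \<le> q} \<le> card {i \<in> descents \<pi>. i < q}) \<and> card N = card (descents \<pi>)"
proof -
  let ?D = "descents \<pi>"
  note facts = Av_312_facts[OF \<pi>]
  have len: "length l = n" using facts(1) l by (metis length_map)
  have D: "1 \<le> i" "i < n" if "i \<in> ?D" for i using descents_bounds[OF that] facts(1) by auto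
  have ball: "(\<forall>p<n. P (Suc p)) \<longleftrightarrow> (\<forall>j\<in>{1..n}. P j)" for P
    by (metis Suc_le_D atLeastAtMost_iff less_eq_Suc_le One_nat_def le0 Suc_le_mono)
  have bottoms: "bottom 1 l p \<longleftrightarrow> p \<in> ?D" if "p < n" for p
    using bottom_iff_descent[OF \<pi> l that] .
  have cN: "card {p. p < q \<and> snd (l ! p)} = card {j \<in> N. j \<le> q}" if "q \<le> n" for q
  proof -
    have "{j \<in> N. j \<le> q} = Suc ` {p. p < q \<and> snd (l ! p)}"
    proof (intro equalityI subsetI)
      fix j assume j: "j \<in> {j \<in> N. j \<le> q}"
      then obtain p where "j = Suc p" using N(1) by (cases j) auto
      then show "j \<in> Suc ` {p. p < q \<and> snd (l ! p)}" using j N(2) that by auto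
    qed (use N(2) that in auto)
    then show ?thesis by (simp add: card_image)
  qed
  have cD: "{p. p < q \<and> bottom 1 l p} = {i \<in> ?D. i < q}" if "q \<le> n" for q
    using bottoms that by auto
  \<comment> \<open>Both counts are constant from \<open>n\<close> on, so the ballot condition need
    only be checked up to \<open>n\<close>.\<close>
  have allN: "{j \<in> N. j \<le> q} = N" if "n \<le> q" for q using N(1) that by force
  have allD: "{i \<in> ?D. i < q} = ?D" if "n \<le> q" for q using D that by force
  have b: "(\<forall>q\<le>n. card {p. p < q \<and> snd (l ! p)} \<le> 0 + card {p. p < q \<and> bottom 1 l p}) \<longleftrightarrow>
      (\<forall>q. card {j \<in> N. j \<le> q} \<le> card {i \<in> ?D. i < q})" (is "?L \<longleftrightarrow> ?R")
  proof
    assume L: ?L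
    show ?R
    proof
      fix q
      show "card {j \<in> N. j \<le> q} \<le> card {i \<in> ?D. i < q}"
      proof (cases "q \<le> n")
        case True
        then show ?thesis using L cN cD by simp
      next
        case False
        have "card {j \<in> N. j \<le> n} \<le> card {i \<in> ?D. i < n}" using L cN cD by simp
        then show ?thesis using False allN allD by simp
      qed
    qed
  qed (use cN cD in simp)
  have c: "card {p. p < n \<and> snd (l ! p)} = 0 + card {p. p < n \<and> bottom 1 l p} \<longleftrightarrow> card N = card ?D"
    using cN[of n] cD[of n] allN[of n] allD[of n] by simp
  have d: "(\<forall>p<n. bottom 1 l p \<longrightarrow> \<not> snd (l ! p)) \<longleftrightarrow> N \<subseteq> {1..n} - Suc ` ?D"
  proof -
    have "(\<forall>p<n. bottom 1 l p \<longrightarrow> \<not> snd (l ! p)) \<longleftrightarrow> (\<forall>p<n. p \<in> ?D \<longrightarrow> Suc p \<notin> N)"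
      using bottoms N(2) by auto
    also have "\<dots> \<longleftrightarrow> N \<inter> Suc ` ?D = {}" using D by auto
    finally show ?thesis using N(1) by auto
  qed
  have e: "(\<forall>p<n. bottom 1 l p \<or> snd (l ! p) \<or> Suc p < n \<and> bottom 1 l (Suc p)) \<longleftrightarrow>
      {1..n} \<subseteq> ?D \<union> N \<union> Suc ` ?D"
  proof -
    have "(\<forall>p<n. bottom 1 l p \<or> snd (l ! p) \<or> Suc p < n \<and> bottom 1 l (Suc p)) \<longleftrightarrow>
        (\<forall>p<n. Suc p \<in> ?D \<union> N \<union> Suc ` ?D)"
      using bottoms N(2) D(2) by auto
    then show ?thesis unfolding ball[of "\<lambda>j. j \<in> ?D \<union> N \<union> Suc ` ?D"] by blast
  qed
  show ?thesis unfolding marking_iff len b c d e by blast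
qed

text \<open>Only the NE endpoints are recorded: the SW endpoints are the descents, and the pairing
  can be recovered as the noncrossing one.\<close>

definition marked_word :: "nat list \<times> (nat \<times> nat) set \<Rightarrow> (nat \<times> bool) list" where
  "marked_word = (\<lambda>(\<pi>, H). map (\<lambda>p. (\<pi> ! p, Suc p \<in> snd ` H)) [0..<length \<pi>])"

definition marked_words :: "nat \<Rightarrow> nat \<Rightarrow> (nat \<times> bool) list set" where
  "marked_words k n = {l. stack_output 1 [] (map fst l) \<and> marking 1 0 l \<and>
     length l = n \<and> length (filter snd l) = k}"

lemma RedVHC_iff:
  "(\<pi>, H) \<in> RedVHC k (Av_312 n) \<longleftrightarrow>
     \<pi> \<in> Av_312 n \<and> noncrossing_matching (descents \<pi>) (snd ` H) H \<and>
     snd ` H \<subseteq> {1..n} - Suc ` descents \<pi> \<and>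
     {1..n} \<subseteq> descents \<pi> \<union> snd ` H \<union> Suc ` descents \<pi> \<and> card (snd ` H) = k"
proof (cases "\<pi> \<in> Av_312 n \<and> noncrossing_matching (descents \<pi>) (snd ` H) H")
  case True
  then have "fst ` H = descents \<pi>" "card (snd ` H) = card H"
    by (auto simp: noncrossing_matching_def card_image)
  then show ?thesis
    using True valid_hook_config_iff[of \<pi> n H] reduced_iff[of \<pi> n H] Av_312_facts(1)[of \<pi> n]
    unfolding RedVHC_def by auto
next
  case False
  then show ?thesis using valid_hook_config_iff[of \<pi> n H] by (auto simp: RedVHC_def)
qed

lemma marked_word_nth:
  assumes "length \<pi> = n" "p < n"
  shows "marked_word (\<pi>, H) ! p = (\<pi> ! p, Suc p \<in> snd ` H)"
  using assms by (simp add: marked_word_def)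

lemma map_fst_marked_word [simp]: "map fst (marked_word (\<pi>, H)) = \<pi>"
  by (simp add: marked_word_def comp_def map_nth)

lemma length_marked_word [simp]: "length (marked_word (\<pi>, H)) = length \<pi>"
  by (simp add: marked_word_def)

lemma length_filter_snd:
  assumes "length l = n" "N \<subseteq> {1..n}" "\<forall>p<n. snd (l ! p) \<longleftrightarrow> Suc p \<in> N"
  shows "length (filter snd l) = card N"
proof -
  have "N = Suc ` {p. p < n \<and> snd (l ! p)}"
  proof (intro equalityI subsetI)
    fix j assume j: "j \<in> N"
    then obtain p where "j = Suc p" using assms(2) by (cases j) auto
    then show "j \<in> Suc ` {p. p < n \<and> snd (l ! p)}" using j assms(2,3) by auto
  qed (use assms(3) in auto)
  then show ?thesis using assms(1) by (simp add: length_filter_conv_card card_image)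
qed

text \<open>The marks determine the NE endpoints, and the ballot condition gives exactly one
  matching with the descents. Its uniqueness yields injectivity, its existence surjectivity.\<close>

lemma bij_betw_marked_word: "bij_betw marked_word (RedVHC k (Av_312 n)) (marked_words k n)"
  unfolding bij_betw_def
proof
  show "inj_on marked_word (RedVHC k (Av_312 n))"
  proof (rule inj_onI)
    fix c c' assume c: "c \<in> RedVHC k (Av_312 n)" "c' \<in> RedVHC k (Av_312 n)"
      and eq: "marked_word c = marked_word c'"
    obtain \<pi> H \<pi>' H' where [simp]: "c = (\<pi>, H)" "c' = (\<pi>', H')" by force
    have [simp]: "\<pi>' = \<pi>" using arg_cong[OF eq, of "map fst"] by simp
    have \<pi>: "\<pi> \<in> Av_312 n" and H: "snd ` H \<subseteq> {1..n}" "snd ` H' \<subseteq> {1..n}"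
      and m: "noncrossing_matching (descents \<pi>) (snd ` H) H"
        "noncrossing_matching (descents \<pi>) (snd ` H') H'"
      using c by (auto simp: RedVHC_iff)
    have len: "length \<pi> = n" using Av_312_facts(1)[OF \<pi>] .
    have "Suc p \<in> snd ` H \<longleftrightarrow> Suc p \<in> snd ` H'" if "p < n" for p
      using eq marked_word_nth[OF len that, of H] marked_word_nth[OF len that, of H'] by simp
    then have "j \<in> snd ` H \<longleftrightarrow> j \<in> snd ` H'" if "j \<in> {1..n}" for j
      using that by (cases j) auto
    then have N: "snd ` H = snd ` H'" using H by blast
    have fin: "finite (snd ` H)" using H by (metis finite_atLeastAtMost finite_subset)
    have "\<exists>!H. noncrossing_matching (descents \<pi>) (snd ` H') H"
      using noncrossing_matching_exists_unique[OF finite_descents fin]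
        noncrossing_matching_ballot[OF m(1) finite_descents] N by simp
    then show "c = c'" using m N by auto
  qed
  show "marked_word ` RedVHC k (Av_312 n) = marked_words k n"
  proof (intro equalityI subsetI)
    fix l assume "l \<in> marked_word ` RedVHC k (Av_312 n)"
    then obtain \<pi> H where R: "(\<pi>, H) \<in> RedVHC k (Av_312 n)" and l: "l = marked_word (\<pi>, H)" by auto
    then have \<pi>: "\<pi> \<in> Av_312 n" and m: "noncrossing_matching (descents \<pi>) (snd ` H) H"
      and H: "snd ` H \<subseteq> {1..n}" "card (snd ` H) = k" by (auto simp: RedVHC_iff)
    have len: "length \<pi> = n" using Av_312_facts(1)[OF \<pi>] .
    have fst: "map fst l = \<pi>" and snd: "\<forall>p<n. snd (l ! p) \<longleftrightarrow> Suc p \<in> snd ` H"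
      unfolding l using marked_word_nth[OF len] by simp_all
    have red: "snd ` H \<subseteq> {1..n} - Suc ` descents \<pi>"
        "{1..n} \<subseteq> descents \<pi> \<union> snd ` H \<union> Suc ` descents \<pi>"
      using R by (simp_all only: RedVHC_iff)
    have "marking 1 0 l"
      unfolding marking_iff_ballot[OF \<pi> fst H(1) snd]
      by (intro conjI allI red noncrossing_matching_ballot[OF m finite_descents])
    moreover have "length (filter snd l) = k"
      using length_filter_snd[OF _ H(1) snd] H(2) len l by simp
    ultimately show "l \<in> marked_words k n"
      using \<pi> fst len l by (simp add: marked_words_def Av_312_iff_stack_output)
  next
    fix l assume l: "l \<in> marked_words k n"
    define \<pi> where "\<pi> = map fst l"
    define N where "N = Suc ` {p. p < n \<and> snd (l ! p)}"
    have len: "length l = n" and k: "length (filter snd l) = k" and mark: "marking 1 0 l"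
      using l by (auto simp: marked_words_def)
    have \<pi>: "\<pi> \<in> Av_312 n"
      using l by (simp add: marked_words_def Av_312_iff_stack_output \<pi>_def)
    have N: "N \<subseteq> {1..n}" "\<forall>p<n. snd (l ! p) \<longleftrightarrow> Suc p \<in> N" by (auto simp: N_def)
    have ballot: "N \<subseteq> {1..n} - Suc ` descents \<pi>"
        "{1..n} \<subseteq> descents \<pi> \<union> N \<union> Suc ` descents \<pi>"
        "\<And>q. card {j \<in> N. j \<le> q} \<le> card {i \<in> descents \<pi>. i < q}" "card N = card (descents \<pi>)"
      using mark unfolding marking_iff_ballot[OF \<pi> \<pi>_def[symmetric] N] by simp_all
    have "finite N" by (simp add: N_def)
    then obtain H where H: "noncrossing_matching (descents \<pi>) N H"
      using noncrossing_matching_exists_unique[OF finite_descents _ ballot(4,3)] by blast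
    then have snd: "snd ` H = N" by (simp add: noncrossing_matching_def)
    have "(\<pi>, H) \<in> RedVHC k (Av_312 n)"
      unfolding RedVHC_iff snd using \<pi> H ballot(1,2) length_filter_snd[OF len N] k by simp
    moreover have "marked_word (\<pi>, H) = l"
    proof (rule nth_equalityI)
      fix p assume "p < length (marked_word (\<pi>, H))"
      then have p: "p < n" by (simp add: \<pi>_def len)
      then show "marked_word (\<pi>, H) ! p = l ! p"
        using marked_word_nth[of \<pi> n p H] N(2) p len by (simp add: snd \<pi>_def prod_eq_iff)
    qed (simp add: \<pi>_def)
    ultimately show "l \<in> marked_word ` RedVHC k (Av_312 n)" by (metis image_eqI)
  qed
qed

subsection \<open>Underlined duck words\<close>

lemma all_prefix_Cons:
  "(\<forall>u. prefix u (a # w) \<longrightarrow> P u) \<longleftrightarrow> P [] \<and> (\<forall>u. prefix u w \<longrightarrow> P (a # u))"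
  by (auto simp: prefix_Cons)

text \<open>The flag \<open>x\<close> stands in for the missing letter before index 0 and tells
  whether it is X.\<close>

definition underlining :: "bool \<Rightarrow> (letter \<times> bool) list \<Rightarrow> bool" where
  "underlining x v \<longleftrightarrow> (\<forall>p<length v. snd (v ! p) \<longrightarrow>
     fst (v ! p) = Y \<and> \<not> (if p = 0 then x else fst (v ! (p - 1)) = X))"

lemma underlining_Cons:
  "underlining x ((z, u) # v) \<longleftrightarrow> (u \<longrightarrow> z = Y \<and> \<not> x) \<and> underlining (z = X) v"
proof -
  have "(if p = 0 then z = X else fst (v ! (p - 1)) = X) \<longleftrightarrow> fst (((z, u) # v) ! p) = X" for p
    by (cases p) simp_all
  then show ?thesis unfolding underlining_def by (simp only: list.size add_Suc_right add_0_right
      all_less_Suc_shift nth_Cons_0 nth_Cons_Suc fst_conv snd_conv if_True if_False nat.simps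
      diff_Suc_1 simp_thms)
qed

text \<open>The counters \<open>s\<close> and \<open>t\<close> are head starts of X over Y and of Y
  over Z, and the recursion updates them letter by letter.\<close>

lemma duck_suffix_iff:
  "duck_suffix x s t v \<longleftrightarrow>
     s + count_list (map fst v) X = count_list (map fst v) Y \<and>
     t + count_list (map fst v) Y = count_list (map fst v) Z \<and>
     (\<forall>u. prefix u (map fst v) \<longrightarrow>
        count_list u Y \<le> s + count_list u X \<and> count_list u Z \<le> t + count_list u Y) \<and>
     underlining x v"
proof (induction v arbitrary: x s t)
  case Nil
  show ?case by (auto simp: underlining_def)
next
  case (Cons a v)
  obtain z u where a: "a = (z, u)" by force
  \<comment> \<open>When the counter that a leading Y or Z lowers is 0, the empty prefix of the tail
    refutes the inequality.\<close>
  have neg: "\<not> (\<forall>u. prefix u w \<longrightarrow> Suc (count_list u b) \<le> count_list u c \<and> Q u)"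
    "\<not> (\<forall>u. prefix u w \<longrightarrow> Q u \<and> Suc (count_list u b) \<le> count_list u c)"
    for w :: "letter list" and b c Q
    by (auto intro!: exI[of _ "[]"])
  note simps = a all_prefix_Cons underlining_Cons neg
  show ?case
  proof (cases z)
    case X
    then show ?thesis by (auto simp: simps Cons.IH)
  next
    case Y
    show ?thesis
    proof (cases s)
      case 0
      then show ?thesis using Y by (simp add: simps)
    next
      case (Suc s')
      then show ?thesis using Y by (simp add: simps Cons.IH) blast
    qed
  next
    case Z
    show ?thesis
    proof (cases t)
      case 0
      then show ?thesis using Z by (simp add: simps)
    next
      case (Suc t')
      then show ?thesis using Z by (simp add: simps Cons.IH) blast
    qed
  qed
qed

section \<open>Flagged words, stack outputs and underlined duck words\<close>

definition underlining_set :: "(letter \<times> bool) list \<Rightarrow> letter list \<times> nat set" where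
  "underlining_set v = (map fst v, {p. p < length v \<and> snd (v ! p)})"

definition marked_ducks :: "nat \<Rightarrow> nat \<Rightarrow> (letter \<times> bool) list set" where
  "marked_ducks k i = {v. duck_suffix False 0 0 v \<and> length v = 3 * k \<and> length (filter snd v) = i}"

lemma length_letters:
  "length w = count_list w X + count_list w Y + count_list w Z"
proof (induction w)
  case (Cons a w)
  then show ?case by (cases a) auto
qed simp

lemma count_marked_ducks:
  assumes "v \<in> marked_ducks k i"
  shows "count_list (map fst v) X = k" "count_list (map fst v) Y = k" "count_list (map fst v) Z = k"
  using assms length_letters[of "map fst v"] by (auto simp: marked_ducks_def duck_suffix_iff)

text \<open>The number of marks recovers \<open>k\<close> and the length recovers \<open>i\<close>;
  the assumption keeps the subtraction in \<open>3 * k - i\<close> from being truncated.\<close>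

lemma bij_betw_run_stack:
  assumes "i \<le> 3 * k"
  shows "bij_betw (run_stack 1 []) (marked_ducks k i) (marked_words k (3 * k - i))"
  unfolding bij_betw_def
proof
  show "inj_on (run_stack 1 []) (marked_ducks k i)"
    by (rule inj_onI, rule run_stack_inj[of False "[]" 0 _ False _ 1]) (auto simp: marked_ducks_def)
  show "run_stack 1 [] ` marked_ducks k i = marked_words k (3 * k - i)"
  proof (intro equalityI subsetI)
    fix l assume "l \<in> run_stack 1 [] ` marked_ducks k i"
    then obtain v where v: "v \<in> marked_ducks k i" and l: "l = run_stack 1 [] v" by blast
    have duck: "duck_suffix False 0 0 v" "length (filter snd v) = i"
      using v by (auto simp: marked_ducks_def)
    have "stack_output 1 [] (map fst l) \<and> marking 1 0 l"
      unfolding l using duck(1) by (intro run_stack_correct) simp_all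
    moreover have "length l = 3 * k - i"
      using length_run_stack[OF duck(1), of 1 "[]"] duck(2) count_marked_ducks[OF v] l by simp
    moreover have "length (filter snd l) = k"
      unfolding l using length_marks_run_stack count_marked_ducks[OF v] by simp
    ultimately show "l \<in> marked_words k (3 * k - i)" by (simp add: marked_words_def)
  next
    fix l assume l: "l \<in> marked_words k (3 * k - i)"
    then obtain v where v: "duck_suffix False 0 0 v" "run_stack 1 [] v = l"
      using run_stack_surj[of 1 "[]" l 0 False] by (auto simp: marked_words_def)
    have "count_list (map fst v) Z = k"
      using l length_marks_run_stack[of 1 "[]" v] v(2) by (simp add: marked_words_def)
    then have counts: "count_list (map fst v) X = k" "count_list (map fst v) Y = k"
        "count_list (map fst v) Z = k"
      using v(1) by (auto simp: duck_suffix_iff)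
    have "length v = 3 * k" using length_letters[of "map fst v"] counts by simp
    moreover have "length (filter snd v) = i"
      using length_run_stack[OF v(1), of 1 "[]"] v(2) counts l assms by (simp add: marked_words_def)
    ultimately show "l \<in> run_stack 1 [] ` marked_ducks k i"
      using v by (auto simp: marked_ducks_def)
  qed
qed

lemma underlining_iff_subset:
  "underlining False v \<longleftrightarrow> snd (underlining_set v) \<subseteq> Y_not_after_X (map fst v)"
  by (auto simp: underlining_def underlining_set_def Y_not_after_X_def)

lemma bij_betw_underlining_set:
  "bij_betw underlining_set (marked_ducks k i) {(w, U) \<in> underlined_duck_words k. card U = i}"
  unfolding bij_betw_def
proof
  show "inj_on underlining_set (marked_ducks k i)"
  proof (rule inj_onI)
    fix v v' assume "underlining_set v = underlining_set v'"
    then have eq: "map fst v = map fst v'"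
      and U: "{p. p < length v \<and> snd (v ! p)} = {p. p < length v' \<and> snd (v' ! p)}"
      by (simp_all add: underlining_set_def)
    have len: "length v = length v'" using arg_cong[OF eq, of length] by simp
    show "v = v'"
    proof (rule nth_equalityI)
      fix p assume p: "p < length v"
      have "fst (v ! p) = fst (v' ! p)" using arg_cong[OF eq, of "\<lambda>w. w ! p"] p len by simp
      moreover have "snd (v ! p) = snd (v' ! p)"
        using arg_cong[OF U, of "\<lambda>S. p \<in> S"] p len by simp
      ultimately show "v ! p = v' ! p" by (simp add: prod_eq_iff)
    qed (rule len)
  qed
  show "underlining_set ` marked_ducks k i = {(w, U) \<in> underlined_duck_words k. card U = i}"
  proof (intro equalityI subsetI)
    fix c assume "c \<in> underlining_set ` marked_ducks k i"
    then obtain v where v: "v \<in> marked_ducks k i" and c: "c = underlining_set v" by blast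
    then show "c \<in> {(w, U) \<in> underlined_duck_words k. card U = i}"
      using count_marked_ducks[OF v] underlining_iff_subset[of v]
      by (auto simp: marked_ducks_def underlining_set_def underlined_duck_words_def
          dyck_words_3d_def duck_suffix_iff length_filter_conv_card)
  next
    fix c assume "c \<in> {(w, U) \<in> underlined_duck_words k. card U = i}"
    then obtain w U where c: "c = (w, U)" and w: "w \<in> dyck_words_3d k"
      and U: "U \<subseteq> Y_not_after_X w" "card U = i"
      by (auto simp: underlined_duck_words_def)
    define v where "v = map (\<lambda>p. (w ! p, p \<in> U)) [0..<length w]"
    have fst: "map fst v = w" by (simp add: v_def comp_def map_nth)
    have "{p. p < length v \<and> snd (v ! p)} = U"
      using U(1) by (auto simp: v_def Y_not_after_X_def)
    with fst have c': "c = underlining_set v" by (simp add: c underlining_set_def)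
    moreover have "v \<in> marked_ducks k i"
      using w U underlining_iff_subset[of v] length_letters[of w] fst c' arg_cong[OF fst, of length]
      by (auto simp: marked_ducks_def duck_suffix_iff dyck_words_3d_def c underlining_set_def
          length_filter_conv_card)
    ultimately show "c \<in> underlining_set ` marked_ducks k i" by blast
  qed
qed

section \<open>Counting the possible underlinings\<close>

lemma card_positions: "card {p. p < length w \<and> w ! p = a} = count_list w a"
  by (simp add: count_list_eq_length_filter length_filter_conv_card eq_commute)

lemma finite_dyck_words_3d: "finite (dyck_words_3d k)"
proof (rule finite_subset)
  show "dyck_words_3d k \<subseteq> {w. set w \<subseteq> {X, Y, Z} \<and> length w = 3 * k}"
    using length_letters letter.exhaust by (auto simp: dyck_words_3d_def)
qed (rule finite_lists_length_eq, simp)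

lemma finite_Y_not_after_X: "finite (Y_not_after_X w)"
  by (rule finite_subset[of _ "{..<length w}"]) (auto simp: Y_not_after_X_def)

text \<open>Before the first Y there is neither a Y nor a Z, so it follows an X.\<close>

lemma card_Y_not_after_X_less:
  assumes w: "w \<in> dyck_words_3d k" and k: "1 \<le> k"
  shows "card (Y_not_after_X w) < k"
proof -
  let ?Y = "{p. p < length w \<and> w ! p = Y}"
  have card: "card ?Y = k" using w card_positions[of w Y] by (simp add: dyck_words_3d_def)
  have pre: "count_list u Y \<le> count_list u X" "count_list u Z \<le> count_list u Y" if "prefix u w" for u
    using w that by (auto simp: dyck_words_3d_def)
  have "?Y \<noteq> {}" using card k by (metis card.empty not_one_le_zero)
  then have ex: "\<exists>p. p < length w \<and> w ! p = Y" by blast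
  define p where "p = (LEAST p. p < length w \<and> w ! p = Y)"
  have p: "p < length w" "w ! p = Y" using LeastI_ex[OF ex] by (auto simp: p_def)
  have least: "w ! q \<noteq> Y" if "q < p" for q
    using not_less_Least[of q "\<lambda>p. p < length w \<and> w ! p = Y"] that p(1) by (auto simp: p_def)
  have noY: "count_list (take p w) Y = 0"
    using least p(1) by (auto simp: count_list_0_iff in_set_conv_nth)
  then have noZ: "count_list (take p w) Z = 0"
    using pre(2)[of "take p w"] by (simp add: take_is_prefix)
  have "0 < count_list (take (Suc p) w) Y" using p by (simp add: take_Suc_conv_app_nth)
  then have "0 < count_list (take (Suc p) w) X"
    using pre(1)[of "take (Suc p) w"] by (simp add: take_is_prefix)
  then have "0 < count_list (take p w) X" using p by (simp add: take_Suc_conv_app_nth)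
  then have "0 < p" by (cases p) auto
  have "w ! (p - 1) \<noteq> Z"
  proof -
    have "w ! (p - 1) \<in> set (take p w)" using \<open>0 < p\<close> p(1)
      by (auto simp: in_set_conv_nth intro!: exI[of _ "p - 1"])
    then show ?thesis using noZ by (metis count_list_0_iff)
  qed
  then have "w ! (p - 1) = X" using least[of "p - 1"] \<open>0 < p\<close> by (cases "w ! (p - 1)") auto
  then have "p \<notin> Y_not_after_X w" using \<open>0 < p\<close> by (simp add: Y_not_after_X_def)
  moreover have "p \<in> ?Y" using p by simp
  moreover have "Y_not_after_X w \<subseteq> ?Y" by (auto simp: Y_not_after_X_def)
  ultimately have "Y_not_after_X w \<subset> ?Y" by blast
  then have "card (Y_not_after_X w) < card ?Y" by (intro psubset_card_mono) simp_all
  then show ?thesis using card by simp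
qed

text \<open>The underlined Y's are any \<open>i\<close> of the admissible ones, of which a word has
  at most \<open>k - 1\<close>; the words are grouped by that number.\<close>

lemma underlined_Duck_eq_sum:
  assumes "1 \<le> k"
  shows "underlined_Duck k i = (\<Sum>j = i..k - 1. (j choose i) * Duck k j)"
proof -
  let ?D = "dyck_words_3d k" and ?y = "\<lambda>w. card (Y_not_after_X w)"
  have "{(w, U) \<in> underlined_duck_words k. card U = i} =
      Sigma ?D (\<lambda>w. {U. U \<subseteq> Y_not_after_X w \<and> card U = i})"
    by (auto simp: underlined_duck_words_def)
  then have "underlined_Duck k i = (\<Sum>w\<in>?D. card {U. U \<subseteq> Y_not_after_X w \<and> card U = i})"
    unfolding underlined_Duck_def using finite_dyck_words_3d finite_Y_not_after_X
    by (simp add: card_SigmaI)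
  also have "\<dots> = (\<Sum>w\<in>?D. ?y w choose i)"
    by (intro sum.cong refl n_subsets finite_Y_not_after_X)
  also have "\<dots> = (\<Sum>j\<in>{..k - 1}. \<Sum>w\<in>{w \<in> ?D. ?y w = j}. ?y w choose i)"
    using card_Y_not_after_X_less[OF _ assms]
    by (intro sum.group[symmetric] finite_dyck_words_3d) fastforce+
  also have "\<dots> = (\<Sum>j\<in>{..k - 1}. (j choose i) * Duck k j)"
    by (intro sum.cong refl) (simp add: Duck_def mult.commute)
  \<comment> \<open>The binomial coefficient vanishes for \<open>j < i\<close>.\<close>
  also have "\<dots> = (\<Sum>j = i..k - 1. (j choose i) * Duck k j)"
    by (intro sum.mono_neutral_right) auto
  finally show ?thesis .
qed

theorem theorem5p1:
  fixes k i :: nat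
  assumes "k \<ge> 1" and "i \<le> k - 1"
  shows "card (RedVHC k (Av_312 (3 * k - i))) = underlined_Duck k i \<and>
         underlined_Duck k i = (\<Sum>j = i..k - 1. (j choose i) * Duck k j)"
proof
  have "i \<le> 3 * k" using assms by simp
  have "card (RedVHC k (Av_312 (3 * k - i))) = card (marked_words k (3 * k - i))"
    by (rule bij_betw_same_card[OF bij_betw_marked_word])
  also have "\<dots> = card (marked_ducks k i)"
    by (rule bij_betw_same_card[OF bij_betw_run_stack[OF \<open>i \<le> 3 * k\<close>], symmetric])
  also have "\<dots> = underlined_Duck k i"
    unfolding underlined_Duck_def by (rule bij_betw_same_card[OF bij_betw_underlining_set])
  finally show "card (RedVHC k (Av_312 (3 * k - i))) = underlined_Duck k i" .
  show "underlined_Duck k i = (\<Sum>j = i..k - 1. (j choose i) * Duck k j)"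
    by (rule underlined_Duck_eq_sum[OF assms(1)])
qed

end
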